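(* In the viscoelastic setting described in the context, for every unit vector $\mathbf{n}\in\mathbb{R}^d$ the function $p\mapsto\mathbf{K}_\mathbf{n}(p)$, $p\in[0,\infty)$, is a matrix-valued complete Bernstein function (with holomorphic extension given by the same formula $\mathbf{K}_\mathbf{n}(p)=\rho^{1/2}p\,\mathbf{Q}_\mathbf{n}(p)^{-1/2}$ on $\mathbb{C}\setminus\,]-\infty,0]$).
   Context: Matrix notation: for a complex $d\times d$ matrix $\mathbf{X}$, $\Re\mathbf{X}:=\tfrac12(\mathbf{X}+\mathbf{X}^\dagger)$, $\Im\mathbf{X}:=\tfrac1{2\mathrm{i}}(\mathbf{X}-\mathbf{X}^\dagger)$; for Hermitian $\mathbf{X},\mathbf{Y}$, $\mathbf{X}\le\mathbf{Y}$ means $\mathbf{v}^\dagger\mathbf{X}\mathbf{v}\le\mathbf{v}^\dagger\mathbf{Y}\mathbf{v}$ for all $\mathbf{v}\in\mathbb{C}^d$. A function $\mathbf{A}:[0,\infty)\to\mathcal{M}_d$ (real $d\times d$ matrices) is a matrix-valued complete Bernstein function (CBF) if (a) $\mathbf{A}(x)$ is symmetric positive semi-definite for all $x\ge0$, (b) $\mathbf{A}(0)=\lim_{x\to0+}\mathbf{A}(x)$, (c) the restriction to $(0,\infty)$ extends holomorphically to $\mathbb{C}\setminus\,]-\infty,0]$ with $(\Im z)\,\Im\mathbf{A}(z)\ge0$ there. Viscoelastic setting: fix an integer $d\ge1$ and $\rho>0$. Let $S$ be the space of real symmetric $d\times d$ matrices with $\langle\mathbf{E},\mathbf{C}\rangle=\sum_{ij}E_{ij}C_{ij}$,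 and $W$ the space of linear maps of $S$ symmetric for this scalar product; in coordinates $\mathsf{X}\in W$ is an array $X_{ijkl}$. Let $\nu\neq0$ be a positive Radon measure on $[0,\infty)$ with $\nu([0,\infty))<\infty$, and $\mathsf{H}:[0,\infty)\to W$ $\nu$-measurable with $\mathsf{H}(r)$ positive semi-definite and of norm $\le1$ for $\nu$-a.e. $r$. The relaxation modulus is $\mathsf{G}(s)=\int_{[0,\infty)}\mathrm{e}^{-sr}\mathsf{H}(r)\,\nu(\mathrm{d}r)$, $s>0$; $\mathsf{G}^0:=\int_{[0,\infty)}\mathsf{H}\,\mathrm{d}\nu=\lim_{s\to0+}\mathsf{G}(s)$, $\mathsf{G}^\infty:=\nu(\{0\})\mathsf{H}(0)=\lim_{s\to\infty}\mathsf{G}(s)$. For $p\in\mathbb{C}\setminus\,]-\infty,0]$, $\mathsf{Q}(p):=p\int_{[0,\infty)}(p+r)^{-1}\mathsf{H}(r)\,\nu(\mathrm{d}r)$ (equal to $p\int_0^\infty\mathrm{e}^{-pt}\mathsf{G}(t)\,\mathrm{d}t$ for $\Re p>0$). For a unit vector $\mathbf{n}\in\mathbb{R}^d$ and $\mathsf{X}\in W$ let $\mathsf{X}_\mathbf{n}$ be the $d\times d$ matrix $(\mathsf{X}_\mathbf{n})_{ik}=\sum_{j,l}X_{ijkl}n_jn_l$; this defines $\mathbf{Q}_\mathbf{n}(p)$, $\mathsf{H}_\mathbf{n}(r)$, $\mathsf{G}^0_\mathbf{n}$, $\mathsf{G}^\infty_\mathbf{n}$. Standing assumption: $\mathsf{G}^\infty_\mathbf{n}$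 is positive definite for every unit $\mathbf{n}$. Then $\mathbf{Q}_\mathbf{n}(p)$ has no eigenvalue in $]-\infty,0]$ for $p\in\mathbb{C}\setminus\,]-\infty,0]$, and one defines $\mathbf{K}_\mathbf{n}(p):=\rho^{1/2}\,p\,\mathbf{Q}_\mathbf{n}(p)^{-1/2}$, where $\mathbf{Q}_\mathbf{n}(p)^{1/2}$ is the principal square root (the unique square root whose eigenvalues lie in the open right half-plane), and $\mathbf{K}_\mathbf{n}(0):=0$. *)

theory Defs
  imports "HOL-Analysis.Analysis"
begin

text \<open>Fourth-order arrays X_{ijkl} (coordinates of elements of W) are functions
  'n => 'n => 'n => 'n => real; d x d matrices are real^'n^'n / complex^'n^'n
  (d = CARD('n)).\<close>

type_synonym 'n tensor4 = "'n \<Rightarrow> 'n \<Rightarrow> 'n \<Rightarrow> 'n \<Rightarrow> real"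

definition symS :: "real^'n^'n \<Rightarrow> bool" where
  "symS E \<longleftrightarrow> transpose E = E"

definition tapply :: "'n::finite tensor4 \<Rightarrow> real^'n^'n \<Rightarrow> real^'n^'n" where
  "tapply X E = (\<chi> i j. \<Sum>k\<in>UNIV. \<Sum>l\<in>UNIV. X i j k l * E$k$l)"

definition frob :: "real^'n^'n \<Rightarrow> real^'n^'n \<Rightarrow> real" where
  "frob E C = (\<Sum>i\<in>UNIV. \<Sum>j\<in>UNIV. E$i$j * C$i$j)"

text \<open>W: symmetric linear maps of S, in their (canonical) coordinates, i.e. arrays with
  the minor and major symmetries.\<close>
definition inW :: "'n::finite tensor4 \<Rightarrow> bool" where
  "inW X \<longleftrightarrow> (\<forall>i j k l. X i j k l = X j i k l \<and> X i j k l = X i j l k \<and> X i j k l = X k l i j)"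

definition tensor_psd :: "'n::finite tensor4 \<Rightarrow> bool" where
  "tensor_psd X \<longleftrightarrow> (\<forall>E. symS E \<longrightarrow> 0 \<le> frob (tapply X E) E)"

definition tensor_norm_le1 :: "'n::finite tensor4 \<Rightarrow> bool" where
  "tensor_norm_le1 X \<longleftrightarrow> (\<forall>E. symS E \<longrightarrow> frob (tapply X E) (tapply X E) \<le> frob E E)"

definition contr :: "'n::finite tensor4 \<Rightarrow> real^'n \<Rightarrow> real^'n^'n" where
  "contr X nv = (\<chi> i k. \<Sum>j\<in>UNIV. \<Sum>l\<in>UNIV. X i j k l * nv$j * nv$l)"

definition real_posdef :: "real^'n^'n \<Rightarrow> bool" where
  "real_posdef A \<longleftrightarrow> (\<forall>v. v \<noteq> 0 \<longrightarrow> 0 < v \<bullet> (A *v v))"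

definition real_psd :: "real^'n^'n \<Rightarrow> bool" where
  "real_psd A \<longleftrightarrow> (\<forall>v. 0 \<le> v \<bullet> (A *v v))"

definition cmat_of :: "real^'n^'n \<Rightarrow> complex^'n^'n" where
  "cmat_of A = (\<chi> i j. complex_of_real (A$i$j))"

definition cmat_Im :: "complex^'n^'n \<Rightarrow> complex^'n^'n" where
  "cmat_Im X = (\<chi> i j. (X$i$j - cnj (X$j$i)) / (2 * \<i>))"

definition cmat_scale :: "complex \<Rightarrow> complex^'n^'n \<Rightarrow> complex^'n^'n" where
  "cmat_scale c X = (\<chi> i j. c * X$i$j)"

text \<open>0 <= X for Hermitian X: v^dagger X v >= 0 for all v (the form is real).\<close>
definition cmat_nonneg :: "complex^'n^'n \<Rightarrow> bool" where
  "cmat_nonneg X \<longleftrightarrow>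
     (\<forall>v::complex^'n. 0 \<le> Re (\<Sum>i\<in>UNIV. \<Sum>j\<in>UNIV. cnj (v$i) * X$i$j * v$j))"

definition is_eigenvalue :: "complex^'n^'n \<Rightarrow> complex \<Rightarrow> bool" where
  "is_eigenvalue B lam \<longleftrightarrow> (\<exists>v. v \<noteq> 0 \<and> B *v v = lam *s v)"

definition psqrt :: "complex^'n^'n \<Rightarrow> complex^'n^'n" where
  "psqrt A = (THE B. B ** B = A \<and> (\<forall>lam. is_eigenvalue B lam \<longrightarrow> 0 < Re lam))"

definition slit_plane :: "complex set" where
  "slit_plane = - (complex_of_real ` {..0})"

definition mCBF_with_ext :: "(real \<Rightarrow> real^'n^'n) \<Rightarrow> (complex \<Rightarrow> complex^'n^'n) \<Rightarrow> bool" where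
  "mCBF_with_ext A F \<longleftrightarrow>
     (\<forall>x\<ge>0. symS (A x) \<and> real_psd (A x)) \<and>
     (A \<longlongrightarrow> A 0) (at_right 0) \<and>
     (\<forall>i j. (\<lambda>z. F z $ i $ j) holomorphic_on slit_plane) \<and>
     (\<forall>x>0. F (complex_of_real x) = cmat_of (A x)) \<and>
     (\<forall>z\<in>slit_plane. cmat_nonneg (cmat_scale (complex_of_real (Im z)) (cmat_Im (F z))))"

definition is_mCBF :: "(real \<Rightarrow> real^'n^'n) \<Rightarrow> bool" where
  "is_mCBF A \<longleftrightarrow> (\<exists>F. mCBF_with_ext A F)"

definition Qt :: "real measure \<Rightarrow> (real \<Rightarrow> 'n tensor4) \<Rightarrow> complex \<Rightarrow> 'n \<Rightarrow> 'n \<Rightarrow> 'n \<Rightarrow> 'n \<Rightarrow> complex" where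
  "Qt M H p i j k l = p * (LINT r|completion M. complex_of_real (H r i j k l) / (p + complex_of_real r))"

definition Qn :: "real measure \<Rightarrow> (real \<Rightarrow> 'n::finite tensor4) \<Rightarrow> real^'n \<Rightarrow> complex \<Rightarrow> complex^'n^'n" where
  "Qn M H nv p = (\<chi> i k. \<Sum>j\<in>UNIV. \<Sum>l\<in>UNIV. Qt M H p i j k l * complex_of_real (nv$j * nv$l))"

definition Kn :: "real \<Rightarrow> real measure \<Rightarrow> (real \<Rightarrow> 'n::finite tensor4) \<Rightarrow> real^'n \<Rightarrow> complex \<Rightarrow> complex^'n^'n" where
  "Kn \<rho> M H nv p = (if p = 0 then 0
     else cmat_scale (complex_of_real (sqrt \<rho>) * p) (matrix_inv (psqrt (Qn M H nv p))))"

end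

(*
  Write Q(p) = p int h(r) / (p + r) d nu(r) with h(r) = H_n(r). Since p / (p + r) =
  |p|^2 / |p + r|^2 + p r / |p + r|^2, one has Q(p) = a + p b with a real symmetric positive
  definite (thanks to the atom at 0) and b real symmetric positive semi-definite. So v^* Q(p) v
  lies in the cone spanned by 1 and p, which avoids ]-oo, 0]. The inverse square root is
    R(A) = (2 / pi) int_0^(pi/2) (cos^2 t A + sin^2 t I)^(-1) dt,
  and v^* M^(-1) v = cnj (w^* M w) for w = M^(-1) v shows that v^* R(Q(p)) v = s + t cnj p with
  s > 0 and t >= 0. Hence Im (p v^* R v) = s Im p has the sign of Im p, and the same two cones
  locate the eigenvalues of R(Q(p))^(-1) in the right half-plane, so that it is the principal
  root. Near 0 the coercivity of the atom bounds R(Q(x)), whence K(x) = O(x).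
*)
theory Submission
  imports Defs "HOL-Complex_Analysis.Complex_Analysis"
    "HOL-Computational_Algebra.Fundamental_Theorem_Algebra"
begin

section \<open>Calculus of matrix products and inverses\<close>

text \<open>For complex p the matrix Q(p) need not be normal, and its spectrum alone would say
  nothing about the Hermitian imaginary part of a root. The integral of resolvents serves because
  the values of their forms at a fixed vector lie in a convex cone, which integration respects. The
  formula is the classical A^(-1/2) = (1/pi) int_0^oo s^(-1/2) (A + s)^(-1) ds after s = tan^2 t.
  The new integrand is continuous on a compact interval, so differentiation under the integral,
  holomorphy and bounds involve no improper integral. That R(A) squares to the inverse of A is shown
  without functional calculus: along the segment B = 1 + tau (A - 1) the product B R(B)^2 has
  derivative 0, and it equals 1 at tau = 0. The principal root is a definite description, so
  exhibiting one root is not enough. A competitor commutes with its own square, hence with R, and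
  two distinct commuting roots would share an eigenvector with opposite eigenvalues.\<close>

lemma bounded_bilinear_matrix_mult:
  "bounded_bilinear ((**) :: complex^'n^'n \<Rightarrow> complex^'n^'n \<Rightarrow> complex^'n^'n)"
proof -
  have "bilinear ((**) :: complex^'n^'n \<Rightarrow> complex^'n^'n \<Rightarrow> complex^'n^'n)"
    unfolding bilinear_def
    by (intro conjI allI linearI)
       (auto simp: matrix_matrix_mult_def vec_eq_iff sum.distrib algebra_simps scaleR_sum_right)
  then show ?thesis
    by (simp add: bilinear_conv_bounded_bilinear)
qed

interpretation matrix_mult:
  bounded_bilinear "(**) :: complex^'n^'n \<Rightarrow> complex^'n^'n \<Rightarrow> complex^'n^'n"
  by (rule bounded_bilinear_matrix_mult)

lemma matrix_inv_right_left:
  fixes A :: "complex^'n^'n"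
  assumes "invertible A"
  shows "A ** matrix_inv A = mat 1" "matrix_inv A ** A = mat 1"
  using assms someI_ex[of "\<lambda>A'. A ** A' = mat 1 \<and> A' ** A = mat 1"]
  unfolding invertible_def matrix_inv_def by auto

lemma matrix_inv_unique:
  fixes A B :: "complex^'n^'n"
  assumes "A ** B = mat 1"
  shows "matrix_inv A = B"
proof -
  have BA: "B ** A = mat 1"
    using assms matrix_left_right_inverse by blast
  have "invertible A"
    using assms BA invertible_def by blast
  then have "matrix_inv A = matrix_inv A ** (A ** B)"
    by (simp add: assms)
  also have "\<dots> = B"
    using matrix_inv_right_left[OF \<open>invertible A\<close>] by (simp add: matrix_mul_assoc)
  finally show ?thesis .
qed

text \<open>Cramer's rule for the j-th column of the inverse. It exhibits the entries as quotients
  of determinants, from which continuity of the inverse can be read off.\<close>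

lemma matrix_inv_entry:
  fixes A :: "complex^'n^'n"
  assumes "invertible A"
  shows "matrix_inv A $ i $ j = det (\<chi> a b. if b = i then axis j 1 $ a else A $ a $ b) / det A"
proof -
  have "A *v (matrix_inv A *v axis j 1) = axis j 1"
    using matrix_inv_right_left[OF assms] by (simp add: matrix_vector_mul_assoc)
  then have "matrix_inv A *v axis j 1 =
      (\<chi> k. det (\<chi> a b. if b = k then axis j 1 $ a else A $ a $ b) / det A)"
    using cramer[of A] assms invertible_det_nz by blast
  moreover have "(matrix_inv A *v axis j 1) $ i = matrix_inv A $ i $ j"
    by (simp add: matrix_vector_mult_def axis_def if_distrib cong: if_cong)
  ultimately show ?thesis by simp
qed

lemma continuous_on_matrix_inv:
  fixes X :: "'a::topological_space \<Rightarrow> complex^'n^'n"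
  assumes X: "continuous_on S X" and inv: "\<And>x. x \<in> S \<Longrightarrow> invertible (X x)"
  shows "continuous_on S (\<lambda>x. matrix_inv (X x))"
proof -
  have entry: "continuous_on S (\<lambda>x. X x $ a $ b)" for a b
    using X by (intro continuous_intros)
  have ifc: "continuous_on S (\<lambda>x. if b = i then axis j 1 $ a else X x $ a $ b)"
    for a b i :: 'n and j
    using entry by (cases "b = i") auto
  have "continuous_on S (\<lambda>x. det (\<chi> a b. if b = i then axis j 1 $ a else X x $ a $ b) / det (X x))"
    for i j :: 'n
    using inv unfolding det_def
    by (intro continuous_intros entry) (auto simp: ifc invertible_det_nz[symmetric] det_def[symmetric])
  then have "continuous_on S (\<lambda>x. matrix_inv (X x) $ i $ j)" for i j
    using inv by (subst continuous_on_cong[OF refl matrix_inv_entry]) auto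
  then have "continuous_on S (\<lambda>x. \<chi> i j. matrix_inv (X x) $ i $ j)"
    by (intro continuous_on_vec_lambda)
  then show ?thesis by simp
qed

lemma open_invertible: "open {X :: complex^'n^'n. invertible X}"
proof -
  have "continuous_on UNIV (det :: complex^'n^'n \<Rightarrow> complex)"
    unfolding det_def by (intro continuous_intros)
  then have "open (det -` (- {0}) :: (complex^'n^'n) set)"
    by (intro open_vimage) auto
  then show ?thesis
    by (simp add: vimage_def invertible_det_nz)
qed

text \<open>The remainder of the first-order expansion factors exactly as (Y - Z^(-1)) (Z - X) Y
  with Y = X^(-1). Divided by |Z - X| it is bounded by a multiple of |Y - Z^(-1)|, which tends to 0
  by continuity of the inverse.\<close>

lemma has_derivative_matrix_inv:
  fixes X :: "complex^'n^'n"
  assumes X: "invertible X"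
  shows "(matrix_inv has_derivative (\<lambda>H. - (matrix_inv X ** H ** matrix_inv X))) (at X within S)"
proof -
  let ?Y = "matrix_inv X"
  obtain K where K: "K > 0"
      "\<And>(A :: complex^'n^'n) (B :: complex^'n^'n). norm (A ** B) \<le> norm A * norm B * K"
    using matrix_mult.pos_bounded by auto
  have lin: "bounded_linear (\<lambda>H. - (?Y ** H ** ?Y))"
    by (intro bounded_linear_minus bounded_linear_compose[OF matrix_mult.bounded_linear_left]
          matrix_mult.bounded_linear_right)
  have ev: "eventually (\<lambda>Z. invertible Z) (at X)"
    using eventually_at_topological[of invertible X UNIV] open_invertible X by auto
  have "continuous_on {X :: complex^'n^'n. invertible X} matrix_inv"
    by (rule continuous_on_matrix_inv) auto
  then have cont: "(matrix_inv \<longlongrightarrow> ?Y) (at X)"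
    using X at_within_open[OF _ open_invertible, of X] by (auto simp: continuous_on_def)
  have identity: "matrix_inv Z - ?Y - - (?Y ** (Z - X) ** ?Y) = (?Y - matrix_inv Z) ** (Z - X) ** ?Y"
    if "invertible Z" for Z
  proof -
    have "(?Y - matrix_inv Z) ** (Z - X) ** ?Y
        = ?Y ** (Z - X) ** ?Y - (matrix_inv Z ** Z ** ?Y - matrix_inv Z ** (X ** ?Y))"
      by (simp add: matrix_mult.diff_left matrix_mult.diff_right matrix_mul_assoc)
    then show ?thesis
      by (simp add: matrix_inv_right_left[OF that] matrix_inv_right_left[OF X])
  qed
  have "((\<lambda>Z. norm (matrix_inv Z - ?Y - - (?Y ** (Z - X) ** ?Y)) / norm (Z - X)) \<longlongrightarrow> 0) (at X)"
  proof (rule tendsto_sandwich[of "\<lambda>_. 0"])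
    show "eventually (\<lambda>Z. norm (matrix_inv Z - ?Y - - (?Y ** (Z - X) ** ?Y)) / norm (Z - X)
            \<le> norm (?Y - matrix_inv Z) * (K * (norm ?Y * K))) (at X)"
    proof (rule eventually_mono[OF eventually_conj[OF ev eventually_neq_at_within[of X]]])
      fix Z assume Z: "invertible Z \<and> Z \<noteq> X"
      have "norm ((?Y - matrix_inv Z) ** (Z - X) ** ?Y)
          \<le> norm ((?Y - matrix_inv Z) ** (Z - X)) * norm ?Y * K"
        by (rule K)
      also have "\<dots> \<le> (norm (?Y - matrix_inv Z) * norm (Z - X) * K) * norm ?Y * K"
        using K by (intro mult_right_mono) auto
      finally have "norm (matrix_inv Z - ?Y - - (?Y ** (Z - X) ** ?Y))
          \<le> norm (?Y - matrix_inv Z) * (K * (norm ?Y * K)) * norm (Z - X)"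
        using identity[of Z] Z by (simp add: mult_ac)
      then show "norm (matrix_inv Z - ?Y - - (?Y ** (Z - X) ** ?Y)) / norm (Z - X)
            \<le> norm (?Y - matrix_inv Z) * (K * (norm ?Y * K))"
        using Z by (subst pos_divide_le_eq) auto
    qed
    show "((\<lambda>Z. norm (?Y - matrix_inv Z) * (K * (norm ?Y * K))) \<longlongrightarrow> 0) (at X)"
      by (rule tendsto_eq_intros tendsto_norm cont refl)+ simp
  qed auto
  then have "(matrix_inv has_derivative (\<lambda>H. - (?Y ** H ** ?Y))) (at X)"
    using lin by (simp only: has_derivative_iff_norm simp_thms)
  then show ?thesis
    by (rule has_derivative_at_withinI)
qed

lemma has_vector_derivative_matrix_inv:
  fixes X :: "real \<Rightarrow> complex^'n^'n"
  assumes "(X has_vector_derivative D) (at t within S)" "invertible (X t)"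
  shows "((\<lambda>t. matrix_inv (X t)) has_vector_derivative
            - (matrix_inv (X t) ** D ** matrix_inv (X t))) (at t within S)"
  using has_derivative_compose[OF assms(1)[unfolded has_vector_derivative_def]
      has_derivative_matrix_inv[OF assms(2)]]
  by (simp add: has_vector_derivative_def matrix_mult.scaleR_left matrix_mult.scaleR_right)

text \<open>The real derivative of inversion is complex linear in the increment, so in each entry it
  acts as multiplication by a complex number. This is the form that holomorphy of the integral
  requires.\<close>

lemma has_field_derivative_matrix_inv:
  fixes X :: "complex \<Rightarrow> complex^'n^'n" and D :: "complex^'n^'n"
  assumes "\<And>i j. ((\<lambda>z. X z $ i $ j) has_field_derivative D $ i $ j) (at z within S)"
    and "invertible (X z)"
  shows "((\<lambda>z. matrix_inv (X z) $ i $ j) has_field_derivative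
            - (matrix_inv (X z) ** D ** matrix_inv (X z)) $ i $ j) (at z within S)"
proof -
  let ?mul = "\<lambda>h. \<chi> i j. D $ i $ j * h"
  have entry: "((\<lambda>z. X z $ a $ b) has_derivative (\<lambda>h. D $ a $ b * h)) (at z within S)" for a b
    using assms(1)[of a b] by (simp add: has_field_derivative_def)
  have "(X has_derivative ?mul) (at z within S)"
  proof (subst has_derivative_componentwise_within, rule ballI)
    fix e :: "complex^'n^'n" assume "e \<in> Basis"
    then obtain a b and c :: complex where e: "e = axis a (axis b c)"
      by (auto simp: Basis_vec_def)
    show "((\<lambda>z. X z \<bullet> e) has_derivative (\<lambda>h. ?mul h \<bullet> e)) (at z within S)"
      using has_derivative_inner_left[OF entry[of a b], of c] by (simp add: e inner_axis)
  qed
  from has_derivative_compose[OF this has_derivative_matrix_inv[OF assms(2)]]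
  have "((\<lambda>z. matrix_inv (X z)) has_derivative
      (\<lambda>h. - (matrix_inv (X z) ** ?mul h ** matrix_inv (X z)))) (at z within S)" .
  then have "((\<lambda>z. matrix_inv (X z) $ i $ j) has_derivative
      (\<lambda>h. (- (matrix_inv (X z) ** ?mul h ** matrix_inv (X z))) $ i $ j)) (at z within S)"
    by (intro bounded_linear.has_derivative[OF bounded_linear_compose[OF bounded_linear_vec_nth bounded_linear_vec_nth]])
  moreover have "(- (matrix_inv (X z) ** ?mul h ** matrix_inv (X z))) $ i $ j =
      (- (matrix_inv (X z) ** D ** matrix_inv (X z)) $ i $ j) * h" for h
    by (simp add: matrix_matrix_mult_def sum_distrib_left sum_distrib_right mult_ac)
  ultimately show ?thesis
    by (simp only: has_field_derivative_def)
qed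

section \<open>The inverse square root as an integral of resolvents\<close>

text \<open>Absence of eigenvalues in ]-oo, 0], in homogeneous form: for t > 0 the condition
  concerns the value -s/t. Nonnegative pairs (s, t) cover both the arc of integration and the
  segment from the identity to \<open>A\<close>.\<close>

definition regular_pencil :: "complex^'n^'n \<Rightarrow> bool" where
  "regular_pencil A \<longleftrightarrow>
     (\<forall>s t::real. 0 \<le> s \<longrightarrow> 0 \<le> t \<longrightarrow> 0 < s + t \<longrightarrow> invertible (t *\<^sub>R A + s *\<^sub>R mat 1))"

text \<open>With s = tan^2 \<phi> one has (A + s)^(-1) = cos^2 \<phi> times the inverse of this
  matrix, and s^(-1/2) cos^2 \<phi> ds = 2 d\<phi>. Hence the constant weight \<open>2 / pi\<close>
  in \<open>isqrt\<close>, and an integrand that remains regular at both ends.\<close>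

definition arc_pencil :: "complex^'n^'n \<Rightarrow> real \<Rightarrow> complex^'n^'n" where
  "arc_pencil A \<phi> = (cos \<phi>)\<^sup>2 *\<^sub>R A + (sin \<phi>)\<^sup>2 *\<^sub>R mat 1"

definition isqrt :: "complex^'n^'n \<Rightarrow> complex^'n^'n" where
  "isqrt A = (2 / pi) *\<^sub>R integral {0..pi/2} (\<lambda>\<phi>. matrix_inv (arc_pencil A \<phi>))"

section \<open>Algebraic identities for the resolvent integral\<close>

lemma invertible_arc: "regular_pencil A \<Longrightarrow> invertible (arc_pencil A \<phi>)"
  by (simp add: regular_pencil_def arc_pencil_def)

lemma continuous_on_arc [continuous_intros]: "continuous_on S (arc_pencil A)"
  unfolding arc_pencil_def by (intro continuous_intros)

lemma continuous_on_inv_arc: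
  "regular_pencil A \<Longrightarrow> continuous_on S (\<lambda>\<phi>. matrix_inv (arc_pencil A \<phi>))"
  by (intro continuous_on_matrix_inv continuous_on_arc invertible_arc)

lemma integrable_inv_arc:
  "regular_pencil A \<Longrightarrow> (\<lambda>\<phi>. matrix_inv (arc_pencil A \<phi>)) integrable_on {a..b}"
  by (intro integrable_continuous_real continuous_on_inv_arc)

lemma matrix_inv_commute:
  fixes A B :: "complex^'n^'n"
  assumes "invertible A" "B ** A = A ** B"
  shows "B ** matrix_inv A = matrix_inv A ** B"
proof -
  have "matrix_inv A ** (B ** A) ** matrix_inv A = matrix_inv A ** (A ** B) ** matrix_inv A"
    using assms by simp
  then have "matrix_inv A ** B ** (A ** matrix_inv A) = matrix_inv A ** A ** B ** matrix_inv A"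
    by (simp add: matrix_mul_assoc)
  then show ?thesis
    by (simp add: matrix_inv_right_left[OF assms(1)])
qed

lemma inv_arc_commute:
  fixes A B :: "complex^'n^'n"
  assumes "regular_pencil A" "B ** A = A ** B"
  shows "B ** matrix_inv (arc_pencil A \<phi>) = matrix_inv (arc_pencil A \<phi>) ** B"
  using assms
  by (intro matrix_inv_commute invertible_arc)
     (auto simp: arc_pencil_def matrix_mult.add_left matrix_mult.add_right
        matrix_mult.scaleR_left matrix_mult.scaleR_right)

text \<open>Commutation with \<open>A\<close> passes to each resolvent and through the integral. It
  is used for \<open>B\<close> equal to \<open>A\<close> itself, to the direction of a segment, and
  to an arbitrary square root of \<open>A\<close>.\<close>

lemma isqrt_commute:
  fixes A B :: "complex^'n^'n"
  assumes "regular_pencil A" "B ** A = A ** B"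
  shows "B ** isqrt A = isqrt A ** B"
proof -
  have "B ** integral {0..pi/2} (\<lambda>\<phi>. matrix_inv (arc_pencil A \<phi>))
      = integral {0..pi/2} (\<lambda>\<phi>. B ** matrix_inv (arc_pencil A \<phi>))"
    using integral_linear[OF integrable_inv_arc[OF assms(1)] matrix_mult.bounded_linear_right, of 0 "pi/2" B]
    by (simp add: o_def)
  also have "\<dots> = integral {0..pi/2} (\<lambda>\<phi>. matrix_inv (arc_pencil A \<phi>) ** B)"
    using inv_arc_commute[OF assms] by simp
  also have "\<dots> = integral {0..pi/2} (\<lambda>\<phi>. matrix_inv (arc_pencil A \<phi>)) ** B"
    using integral_linear[OF integrable_inv_arc[OF assms(1)] matrix_mult.bounded_linear_left, of 0 "pi/2" B]
    by (simp add: o_def)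
  finally show ?thesis
    by (simp add: isqrt_def matrix_mult.scaleR_left matrix_mult.scaleR_right)
qed

lemma has_vector_derivative_arc:
  "(arc_pencil A has_vector_derivative (2 * sin \<phi> * cos \<phi>) *\<^sub>R (mat 1 - A)) (at \<phi> within S)"
  unfolding arc_pencil_def[abs_def]
  by (auto intro!: derivative_eq_intros simp: has_real_derivative_iff_has_vector_derivative[symmetric]
        scaleR_diff_right algebra_simps)

text \<open>The integrand is the exact derivative of sin \<phi> cos \<phi> times the inverse of the
  arc pencil, and this primitive vanishes at 0 and at pi/2.\<close>

lemma integral_inv_arc_square:
  fixes A :: "complex^'n^'n"
  assumes A: "regular_pencil A"
  shows "((\<lambda>\<phi>. matrix_inv (arc_pencil A \<phi>) ** ((cos \<phi>)\<^sup>2 *\<^sub>R A - (sin \<phi>)\<^sup>2 *\<^sub>R mat 1) ** matrix_inv (arc_pencil A \<phi>))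
           has_integral 0) {0..pi/2}"
proof -
  let ?Y = "\<lambda>\<phi>. matrix_inv (arc_pencil A \<phi>)"
  have "((\<lambda>\<phi>. (sin \<phi> * cos \<phi>) *\<^sub>R ?Y \<phi>) has_vector_derivative
      ?Y \<phi> ** ((cos \<phi>)\<^sup>2 *\<^sub>R A - (sin \<phi>)\<^sup>2 *\<^sub>R mat 1) ** ?Y \<phi>) (at \<phi> within {0..pi/2})" for \<phi>
  proof -
    let ?M' = "(2 * sin \<phi> * cos \<phi>) *\<^sub>R (mat 1 - A)"
    have d1: "(?Y has_vector_derivative - (?Y \<phi> ** ?M' ** ?Y \<phi>)) (at \<phi> within {0..pi/2})"
      by (intro has_vector_derivative_matrix_inv has_vector_derivative_arc invertible_arc A)
    have d2: "((\<lambda>\<phi>. sin \<phi> * cos \<phi>) has_real_derivative (cos \<phi>)\<^sup>2 - (sin \<phi>)\<^sup>2) (at \<phi> within {0..pi/2})"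
      by (auto intro!: derivative_eq_intros simp: power2_eq_square)
    have "((\<lambda>\<phi>. (sin \<phi> * cos \<phi>) *\<^sub>R ?Y \<phi>) has_vector_derivative
        (sin \<phi> * cos \<phi>) *\<^sub>R - (?Y \<phi> ** ?M' ** ?Y \<phi>) + ((cos \<phi>)\<^sup>2 - (sin \<phi>)\<^sup>2) *\<^sub>R ?Y \<phi>)
        (at \<phi> within {0..pi/2})"
      by (rule has_vector_derivative_scaleR[OF d2 d1])
    moreover have "(sin \<phi> * cos \<phi>) *\<^sub>R - (?Y \<phi> ** ?M' ** ?Y \<phi>) + ((cos \<phi>)\<^sup>2 - (sin \<phi>)\<^sup>2) *\<^sub>R ?Y \<phi>
      = ?Y \<phi> ** (- ((sin \<phi> * cos \<phi>) *\<^sub>R ?M') + ((cos \<phi>)\<^sup>2 - (sin \<phi>)\<^sup>2) *\<^sub>R arc_pencil A \<phi>) ** ?Y \<phi>"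
      by (simp add: matrix_mult.add_left matrix_mult.add_right matrix_mult.scaleR_left
          matrix_mult.scaleR_right matrix_mult.minus_left matrix_mult.minus_right
          matrix_mult.diff_left matrix_mult.diff_right scaleR_diff_right
          matrix_inv_right_left[OF invertible_arc[OF A]])
    moreover have "- ((sin \<phi> * cos \<phi>) *\<^sub>R ?M') + ((cos \<phi>)\<^sup>2 - (sin \<phi>)\<^sup>2) *\<^sub>R arc_pencil A \<phi>
        = (cos \<phi>)\<^sup>2 *\<^sub>R A - (sin \<phi>)\<^sup>2 *\<^sub>R mat 1"
    proof -
      \<comment> \<open>Replacing sin^2 by 1 - cos^2 turns the coefficients of \<open>A\<close> and
        of the identity into polynomials in cos^2, which can be compared directly.\<close>
      have c: "- (sin \<phi> * cos \<phi> * (2 * sin \<phi> * cos \<phi>)) = - 2 * (1 - (cos \<phi>)\<^sup>2) * (cos \<phi>)\<^sup>2"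
        unfolding sin_squared_eq[symmetric] by (simp add: power2_eq_square)
      have "- ((sin \<phi> * cos \<phi>) *\<^sub>R ?M') = (- (sin \<phi> * cos \<phi> * (2 * sin \<phi> * cos \<phi>))) *\<^sub>R (mat 1 - A)"
        by simp
      then show ?thesis
        unfolding c arc_pencil_def sin_squared_eq
        by (simp add: vec_eq_iff algebra_simps scaleR_conv_of_real power2_eq_square)
    qed
    ultimately show ?thesis by simp
  qed
  from fundamental_theorem_of_calculus[OF _ this]
  show ?thesis by simp
qed

text \<open>Differentiating along the segment from the identity to \<open>A\<close> turns the identity
  \<open>A R(A)\<^sup>2 = 1\<close> into the vanishing integral of a \<open>\<phi>\<close>-derivative.\<close>

lemma mult_isqrt_square:
  fixes A :: "complex^'n^'n"
  assumes A: "regular_pencil A"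
  shows "A ** isqrt A ** isqrt A = mat 1"
proof -
  let ?D = "A - mat 1"
  define B where "B \<tau> = mat 1 + \<tau> *\<^sub>R ?D" for \<tau> :: real
  define R where "R \<tau> = isqrt (B \<tau>)" for \<tau>
  define Y where "Y \<tau> \<phi> = matrix_inv (arc_pencil (B \<tau>) \<phi>)" for \<tau> \<phi>
  \<comment> \<open>A nonnegative combination of \<open>B \<tau>\<close> and the identity is one of
    \<open>A\<close> and the identity, with the same sum of coefficients s + t, so the hypothesis on
    \<open>A\<close> covers the whole segment.\<close>
  have pencil: "regular_pencil (B \<tau>)" if "\<tau> \<in> {0..1}" for \<tau>
    unfolding regular_pencil_def
  proof (intro allI impI)
    fix s t :: real assume st: "0 \<le> s" "0 \<le> t" "0 < s + t"
    have "t *\<^sub>R B \<tau> + s *\<^sub>R mat 1 = (t * \<tau>) *\<^sub>R A + (t * (1 - \<tau>) + s) *\<^sub>R mat 1"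
      by (simp add: B_def algebra_simps)
    moreover have "0 \<le> t * \<tau>" "0 \<le> t * (1 - \<tau>) + s" "0 < t * (1 - \<tau>) + s + t * \<tau>"
      using st that by (auto simp: algebra_simps mult_left_le_one_le add_increasing)
    ultimately show "invertible (t *\<^sub>R B \<tau> + s *\<^sub>R mat 1)"
      using A[unfolded regular_pencil_def, rule_format, of "t * (1 - \<tau>) + s" "t * \<tau>"] by simp
  qed
  have DB: "?D ** B \<tau> = B \<tau> ** ?D" for \<tau>
    by (simp add: B_def matrix_mult.add_left matrix_mult.add_right matrix_mult.scaleR_left
          matrix_mult.scaleR_right)
  have Bd: "(B has_vector_derivative ?D) (at \<tau> within S)" for \<tau> S
    unfolding B_def[abs_def] by (auto intro!: derivative_eq_intros)
  have deriv: "((\<lambda>\<tau>. B \<tau> ** (R \<tau> ** R \<tau>)) has_vector_derivative 0) (at \<tau> within {0..1})"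
    if \<tau>: "\<tau> \<in> {0..1}" for \<tau>
  proof -
    let ?dY = "\<lambda>\<tau> \<phi>. - (Y \<tau> \<phi> ** ((cos \<phi>)\<^sup>2 *\<^sub>R ?D) ** Y \<tau> \<phi>)"
    define R' where "R' = (2 / pi) *\<^sub>R integral {0..pi/2} (?dY \<tau>)"
    have arcd: "((\<lambda>\<tau>. arc_pencil (B \<tau>) \<phi>) has_vector_derivative (cos \<phi>)\<^sup>2 *\<^sub>R ?D) (at \<tau> within {0..1})" for \<tau> \<phi>
      unfolding arc_pencil_def using Bd[of \<tau> "{0..1}"] by (auto intro!: derivative_eq_intros)
    have contY: "continuous_on ({0..1} \<times> {0..pi/2}) (\<lambda>x. Y (fst x) (snd x))"
      unfolding Y_def
      by (intro continuous_on_matrix_inv invertible_arc pencil)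
         (auto simp: arc_pencil_def B_def intro!: continuous_intros)
    have contdY: "continuous_on ({0..1} \<times> {0..pi/2}) (\<lambda>x. ?dY (fst x) (snd x))"
      by (intro continuous_intros matrix_mult.continuous_on contY)
    have "((\<lambda>\<tau>. integral (cbox 0 (pi/2)) (Y \<tau>)) has_vector_derivative
        integral (cbox 0 (pi/2)) (?dY \<tau>)) (at \<tau> within {0..1})"
    proof (rule leibniz_rule_vector_derivative)
      show "((\<lambda>\<tau>. Y \<tau> \<phi>) has_vector_derivative ?dY \<tau> \<phi>) (at \<tau> within {0..1})"
        if "\<tau> \<in> {0..1}" for \<tau> \<phi>
        unfolding Y_def using that
        by (intro has_vector_derivative_matrix_inv arcd invertible_arc pencil)
      show "Y \<tau> integrable_on cbox 0 (pi/2)" if "\<tau> \<in> {0..1}" for \<tau>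
        unfolding Y_def cbox_interval using that by (intro integrable_inv_arc pencil)
      show "continuous_on ({0..1} \<times> cbox 0 (pi/2)) (\<lambda>(\<tau>, \<phi>). ?dY \<tau> \<phi>)"
        using contdY by (simp add: case_prod_beta)
    qed (use \<tau> in auto)
    then have Rd: "(R has_vector_derivative R') (at \<tau> within {0..1})"
      unfolding R_def[abs_def] R'_def isqrt_def Y_def
      by (auto intro!: derivative_eq_intros)
    have intdY: "?dY \<tau> integrable_on {0..pi/2}"
      unfolding Y_def
      by (intro integrable_continuous_real continuous_intros matrix_mult.continuous_on
          continuous_on_inv_arc pencil \<tau>)
    \<comment> \<open>This is the differential equation of B^(-1/2) along the segment: formally R' =
      -(1/2) B^(-1) D R, multiplied by B.\<close>
    have BR': "B \<tau> ** R' = - (1/2) *\<^sub>R (?D ** R \<tau>)"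
    proof -
      let ?E = "\<lambda>\<phi>. Y \<tau> \<phi> ** ((cos \<phi>)\<^sup>2 *\<^sub>R B \<tau> - (sin \<phi>)\<^sup>2 *\<^sub>R mat 1) ** Y \<tau> \<phi>"
      \<comment> \<open>The two sides of the differential equation differ, before integration, by a
        multiple of D times the integrand whose integral vanishes. The second term is brought to a
        common shape by writing Y as Y (cos^2 B + sin^2) Y.\<close>
      have comm: "B \<tau> ** ?dY \<tau> \<phi> + (1/2) *\<^sub>R (?D ** Y \<tau> \<phi>) = (- 1/2) *\<^sub>R (?D ** ?E \<phi>)" for \<phi>
      proof -
        let ?Z = "Y \<tau> \<phi>"
        have BY: "B \<tau> ** ?Z = ?Z ** B \<tau>" and DY: "?D ** ?Z = ?Z ** ?D"
          unfolding Y_def using DB by (intro inv_arc_commute pencil \<tau>; simp)+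
        have "?Z = ?Z ** arc_pencil (B \<tau>) \<phi> ** ?Z"
          unfolding Y_def using matrix_inv_right_left[OF invertible_arc[OF pencil[OF \<tau>]]] by simp
        then have "?D ** ?Z = ?D ** (?Z ** arc_pencil (B \<tau>) \<phi> ** ?Z)" by simp
        also have "?Z ** arc_pencil (B \<tau>) \<phi> ** ?Z
            = (cos \<phi>)\<^sup>2 *\<^sub>R (?Z ** B \<tau> ** ?Z) + (sin \<phi>)\<^sup>2 *\<^sub>R (?Z ** ?Z)"
          by (simp add: arc_pencil_def matrix_mult.add_left matrix_mult.add_right matrix_mult.scaleR_left
              matrix_mult.scaleR_right)
        finally have 1: "?D ** ?Z = (cos \<phi>)\<^sup>2 *\<^sub>R (?D ** (?Z ** B \<tau> ** ?Z)) + (sin \<phi>)\<^sup>2 *\<^sub>R (?D ** (?Z ** ?Z))"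
          by (simp add: matrix_mult.add_right matrix_mult.scaleR_right)
        have "B \<tau> ** (?Z ** ?D ** ?Z) = B \<tau> ** ?D ** ?Z ** ?Z"
          unfolding DY[symmetric] by (simp add: matrix_mul_assoc)
        also have "\<dots> = ?D ** (B \<tau> ** ?Z) ** ?Z"
          unfolding DB[symmetric] by (simp add: matrix_mul_assoc)
        also have "\<dots> = ?D ** (?Z ** B \<tau> ** ?Z)"
          unfolding BY by (simp add: matrix_mul_assoc)
        finally have 2: "B \<tau> ** ?dY \<tau> \<phi> = - ((cos \<phi>)\<^sup>2 *\<^sub>R (?D ** (?Z ** B \<tau> ** ?Z)))"
          by (simp add: matrix_mult.minus_right matrix_mult.scaleR_right matrix_mult.scaleR_left)
        have 3: "?D ** ?E \<phi> = (cos \<phi>)\<^sup>2 *\<^sub>R (?D ** (?Z ** B \<tau> ** ?Z)) - (sin \<phi>)\<^sup>2 *\<^sub>R (?D ** (?Z ** ?Z))"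
          by (simp add: matrix_mult.diff_right matrix_mult.diff_left[of _ _ ?Z]
              matrix_mult.scaleR_right matrix_mult.scaleR_left)
        have alg: "- (x :: complex^'n^'n) + (1/2) *\<^sub>R (x + y) = (- 1/2) *\<^sub>R (x - y)" for x y
          by (simp add: vec_eq_iff complex_eq_iff field_simps)
        show ?thesis
          unfolding 1 2 3 by (rule alg)
      qed
      have i1: "((\<lambda>\<phi>. B \<tau> ** ?dY \<tau> \<phi>) has_integral B \<tau> ** integral {0..pi/2} (?dY \<tau>)) {0..pi/2}"
        using has_integral_linear[OF integrable_integral[OF intdY] matrix_mult.bounded_linear_right]
        by (simp add: o_def)
      have "((\<lambda>\<phi>. ?D ** Y \<tau> \<phi>) has_integral ?D ** integral {0..pi/2} (Y \<tau>)) {0..pi/2}"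
        using has_integral_linear[OF integrable_integral[OF integrable_inv_arc[OF pencil[OF \<tau>]]]
            matrix_mult.bounded_linear_right]
        by (simp add: o_def Y_def[abs_def])
      from has_integral_add[OF i1 has_integral_cmul[OF this, of "1/2"]]
      have "((\<lambda>\<phi>. (- 1/2) *\<^sub>R (?D ** ?E \<phi>)) has_integral
          B \<tau> ** integral {0..pi/2} (?dY \<tau>) + (1/2) *\<^sub>R (?D ** integral {0..pi/2} (Y \<tau>))) {0..pi/2}"
        unfolding comm .
      moreover have "((\<lambda>\<phi>. (- 1/2) *\<^sub>R (?D ** ?E \<phi>)) has_integral 0) {0..pi/2}"
      proof -
        have "(?E has_integral 0) {0..pi/2}"
          unfolding Y_def by (rule integral_inv_arc_square[OF pencil[OF \<tau>]])
        from has_integral_linear[OF this matrix_mult.bounded_linear_right]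
        have "((\<lambda>\<phi>. ?D ** ?E \<phi>) has_integral 0) {0..pi/2}"
          by (simp only: o_def matrix_mult.zero_right)
        from has_integral_cmul[OF this, of "- 1/2"] show ?thesis
          by (simp only: scaleR_zero_right)
      qed
      ultimately have "B \<tau> ** integral {0..pi/2} (?dY \<tau>) + (1/2) *\<^sub>R (?D ** integral {0..pi/2} (Y \<tau>)) = 0"
        by (rule has_integral_unique)
      then have "B \<tau> ** integral {0..pi/2} (?dY \<tau>) = - (1/2) *\<^sub>R (?D ** integral {0..pi/2} (Y \<tau>))"
        by (simp only: add_eq_0_iff2 scaleR_minus_left)
      then show ?thesis
        unfolding R'_def R_def isqrt_def Y_def[abs_def] matrix_mult.scaleR_right
        by (simp only: scaleR_left_commute[of "2 / pi"])
    qed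
    have DR: "?D ** R \<tau> = R \<tau> ** ?D" and BR: "B \<tau> ** R \<tau> = R \<tau> ** B \<tau>"
      unfolding R_def using DB by (intro isqrt_commute pencil \<tau>; simp)+
    have "((\<lambda>\<tau>. B \<tau> ** (R \<tau> ** R \<tau>)) has_vector_derivative
        B \<tau> ** (R \<tau> ** R' + R' ** R \<tau>) + ?D ** (R \<tau> ** R \<tau>)) (at \<tau> within {0..1})"
      by (intro matrix_mult.has_vector_derivative Bd Rd)
    moreover have "B \<tau> ** (R \<tau> ** R' + R' ** R \<tau>) + ?D ** (R \<tau> ** R \<tau>) = 0"
    proof -
      have "B \<tau> ** (R \<tau> ** R') = R \<tau> ** (B \<tau> ** R')"
        by (metis BR matrix_mul_assoc)
      also have "\<dots> = (- 1/2) *\<^sub>R (?D ** (R \<tau> ** R \<tau>))"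
        unfolding BR' by (simp add: matrix_mult.minus_right matrix_mult.scaleR_right matrix_mul_assoc DR[symmetric])
      finally have 1: "B \<tau> ** (R \<tau> ** R') = (- 1/2) *\<^sub>R (?D ** (R \<tau> ** R \<tau>))" .
      have "B \<tau> ** (R' ** R \<tau>) = (B \<tau> ** R') ** R \<tau>"
        by (simp add: matrix_mul_assoc)
      also have "\<dots> = (- 1/2) *\<^sub>R (?D ** (R \<tau> ** R \<tau>))"
        unfolding BR' by (simp add: matrix_mult.minus_left matrix_mult.scaleR_left matrix_mul_assoc)
      finally have 2: "B \<tau> ** (R' ** R \<tau>) = (- 1/2) *\<^sub>R (?D ** (R \<tau> ** R \<tau>))" .
      have alg: "(- 1/2) *\<^sub>R x + (- 1/2) *\<^sub>R x + x = 0" for x :: "complex^'n^'n"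
        by (simp add: vec_eq_iff complex_eq_iff)
      show ?thesis
        unfolding matrix_mult.add_right 1 2 by (rule alg)
    qed
    ultimately show ?thesis by simp
  qed
  \<comment> \<open>The constant is read off at \<tau> = 0, where every arc pencil is the identity,
    and then used at \<tau> = 1, where \<open>B \<tau>\<close> is \<open>A\<close>.\<close>
  obtain c where c: "\<And>\<tau>. \<tau> \<in> {0..1} \<Longrightarrow> B \<tau> ** (R \<tau> ** R \<tau>) = c"
    using has_vector_derivative_zero_constant[OF _ deriv] by (metis convex_real_interval(5))
  have "arc_pencil (mat 1 :: complex^'n^'n) \<phi> = mat 1" for \<phi>
    by (simp add: arc_pencil_def scaleR_left.add[symmetric])
  then have "R 0 = mat 1"
    by (simp add: R_def B_def isqrt_def matrix_inv_unique[of "mat 1" "mat 1"])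
  then show ?thesis
    using c[of 0] c[of 1] by (simp add: B_def R_def matrix_mul_assoc)
qed

section \<open>Uniqueness of the principal square root\<close>

text \<open>The vector p(B) v, evaluated by Horner's rule. Only the orbit of a single vector is
  needed, so no polynomial calculus of matrices is set up.\<close>

definition poly_orbit :: "complex^'n^'n \<Rightarrow> complex^'n \<Rightarrow> complex poly \<Rightarrow> complex^'n" where
  "poly_orbit B v p = fold_coeffs (\<lambda>a w. a *s v + B *v w) p 0"

lemma poly_orbit_0 [simp]: "poly_orbit B v 0 = 0"
  by (simp add: poly_orbit_def)

lemma poly_orbit_pCons [simp]: "poly_orbit B v (pCons a p) = a *s v + B *v poly_orbit B v p"
  by (cases "p = 0 \<and> a = 0") (auto simp: poly_orbit_def)

lemma poly_orbit_add: "poly_orbit B v (p + q) = poly_orbit B v p + poly_orbit B v q"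
  by (induction p q rule: poly_induct2)
     (simp_all add: vec.scale_left_distrib matrix_vector_right_distrib)

lemma poly_orbit_smult: "poly_orbit B v (smult c p) = c *s poly_orbit B v p"
  by (induction p)
     (simp_all add: vec.scale_right_distrib vector_smult_assoc vec.scale)

lemma poly_orbit_monom: "poly_orbit B v (monom c k) = c *s (((*v) B) ^^ k) v"
  by (induction k) (simp_all add: monom_0 monom_Suc vec.scale)

lemma poly_orbit_sum: "poly_orbit B v (sum f I) = (\<Sum>i\<in>I. poly_orbit B v (f i))"
  by (induction I rule: infinite_finite_induct) (simp_all add: poly_orbit_add)

lemma poly_orbit_kernel:
  fixes B C :: "complex^'n^'n"
  assumes "B ** C = C ** B" "C *v v = 0"
  shows "C *v poly_orbit B v p = 0"
proof (induction p)
  case (pCons a p)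
  have "C *v (B *v poly_orbit B v p) = B *v (C *v poly_orbit B v p)"
    by (simp add: matrix_vector_mul_assoc assms(1))
  then show ?case
    using pCons assms(2) by (simp add: matrix_vector_right_distrib vec.scale)
qed simp

text \<open>The vectors v, B v, ..., B^d v are d + 1 in number in a space of dimension d. A linear
  relation among them gives the coefficients of p.\<close>

lemma annihilating_polynomial:
  fixes B :: "complex^'n^'n"
  shows "\<exists>p. p \<noteq> 0 \<and> poly_orbit B v p = 0"
proof -
  define w where "w k = (((*v) B) ^^ k) v" for k
  let ?I = "{..CARD('n)}"
  show ?thesis
  \<comment> \<open>Linear dependence is a property of the set of orbit vectors, which loses
    repetitions. If two powers of B agree on v, the difference of two monomials annihilates v
    instead.\<close>
  proof (cases "inj_on w ?I")
    case True
    then have "card (w ` ?I) = Suc (CARD('n))"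
      by (simp only: card_image card_atMost)
    moreover have "vec.dim (w ` ?I) \<le> CARD('n)"
      by (rule order_trans[OF vec.dim_subset[OF subset_UNIV]]) (simp only: vec_dim_card order_refl)
    ultimately have "vec.dependent (w ` ?I)"
      by (intro vec.dependent_biggerset_general) (simp only: less_Suc_eq_le)
    then obtain u where u: "\<exists>x\<in>w ` ?I. u x \<noteq> 0" "(\<Sum>x\<in>w ` ?I. u x *s x) = 0"
      unfolding vec.dependent_finite[OF finite_imageI[OF finite_atMost]] by blast
    define p where "p = (\<Sum>k\<in>?I. monom (u (w k)) k)"
    have "poly_orbit B v p = (\<Sum>k\<in>?I. u (w k) *s w k)"
      by (simp add: p_def poly_orbit_sum poly_orbit_monom w_def)
    also have "\<dots> = 0"
      using u(2) sum.reindex[OF True, of "\<lambda>x. u x *s x"] by simp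
    finally have "poly_orbit B v p = 0" .
    moreover obtain k where k: "k \<in> ?I" "u (w k) \<noteq> 0"
      using u(1) by auto
    have "coeff p k = u (w k)"
      using k(1) by (simp add: p_def coeff_sum)
    then have "p \<noteq> 0"
      using k(2) by auto
    ultimately show ?thesis by blast
  next
    case False
    then obtain j k where jk: "j \<noteq> k" "w j = w k"
      by (auto simp: inj_on_def)
    let ?p = "monom 1 j + monom (- 1) k :: complex poly"
    have "poly_orbit B v ?p = 0"
      using jk(2) by (simp add: poly_orbit_add poly_orbit_monom w_def)
    moreover have "coeff ?p j \<noteq> 0"
      using jk(1) by simp
    then have "?p \<noteq> 0" by (metis coeff_0)
    ultimately show ?thesis by blast
  qed
qed

text \<open>The kernel of \<open>C\<close> is invariant under \<open>B\<close>, so the orbit of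
  \<open>v\<close> stays in it. A linear factor X - z is split off from an annihilating polynomial:
  either the cofactor q already annihilates v and has smaller degree, or q(B) v is an eigenvector
  for z.\<close>

lemma eigenvector_in_kernel:
  fixes B C :: "complex^'n^'n"
  assumes comm: "B ** C = C ** B" and v: "v \<noteq> 0" "C *v v = 0"
  shows "\<exists>w lam. w \<noteq> 0 \<and> C *v w = 0 \<and> B *v w = lam *s w"
proof -
  obtain p where "p \<noteq> 0" "poly_orbit B v p = 0"
    using annihilating_polynomial[of B v] by (elim exE conjE)
  then show ?thesis
  proof (induction "degree p" arbitrary: p rule: less_induct)
    case less
    \<comment> \<open>A nonzero constant polynomial would send v to a nonzero multiple of
      itself.\<close>
    have "\<not> constant (poly p)"
    proof
      assume "constant (poly p)"
      then have "poly p = poly [:poly p 0:]"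
        by (auto simp: constant_def fun_eq_iff)
      then have c: "p = [:poly p 0:]"
        by (simp only: poly_eq_poly_eq_iff)
      have "poly p 0 *s v = 0"
        using less.prems(2) by (subst (asm) c) simp
      then show False
        using c less.prems(1) v(1) by (metis pCons_0_0 vec.scale_eq_0_iff)
    qed
    then obtain z where "poly p z = 0"
      using fundamental_theorem_of_algebra by blast
    then obtain q where q: "p = [:- z, 1:] * q"
      by (auto simp: poly_eq_0_iff_dvd dvd_def)
    have "q \<noteq> 0" using q less.prems by auto
    have deg: "degree q < degree p"
      unfolding q using \<open>q \<noteq> 0\<close> by (subst degree_mult_eq) auto
    let ?w = "poly_orbit B v q"
    have p_q: "p = smult (- z) q + pCons 0 q"
      by (simp add: q)
    have "poly_orbit B v p = (- z) *s ?w + B *v ?w"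
      unfolding p_q poly_orbit_add poly_orbit_smult by simp
    then have eig: "B *v ?w = z *s ?w"
      using less.prems by (simp add: vec_eq_iff add_eq_0_iff)
    show ?case
    proof (cases "?w = 0")
      case True
      with less.hyps[OF deg] \<open>q \<noteq> 0\<close> show ?thesis by blast
    next
      case False
      with eig poly_orbit_kernel[OF comm v(2)] show ?thesis by blast
    qed
  qed
qed

text \<open>Commutation gives (B + S) (B - S) = 0. If B and S differ, the kernel of B + S is nonzero
  and contains an eigenvector w of B; there S w = - B w, so B and S have opposite eigenvalues at w,
  which cannot both have positive real part.\<close>

lemma commuting_sqrt_unique:
  fixes B S :: "complex^'n^'n"
  assumes sq: "B ** B = S ** S" and comm: "B ** S = S ** B"
    and B: "\<And>lam. is_eigenvalue B lam \<Longrightarrow> 0 < Re lam"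
    and S: "\<And>lam. is_eigenvalue S lam \<Longrightarrow> 0 < Re lam"
  shows "B = S"
proof (rule ccontr)
  assume "B \<noteq> S"
  then obtain v where v: "(B - S) *v v \<noteq> 0"
    by (metis matrix_eq matrix_vector_mult_0 right_minus_eq)
  have "(B + S) ** (B - S) = 0"
    using sq comm by (simp add: matrix_mult.add_left matrix_mult.diff_right)
  then have "(B + S) *v ((B - S) *v v) = 0"
    by (simp add: matrix_vector_mul_assoc)
  moreover have "B ** (B + S) = (B + S) ** B"
    using comm by (simp add: matrix_mult.add_left matrix_mult.add_right)
  ultimately obtain w lam where w: "w \<noteq> 0" "(B + S) *v w = 0" "B *v w = lam *s w"
    using eigenvector_in_kernel v by blast
  have "S *v w = (- lam) *s w"
    using w(2,3) by (simp add: matrix_vector_mult_add_rdistrib add_eq_0_iff vec_eq_iff)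
  then have "0 < Re (- lam)" "0 < Re lam"
    using B S w unfolding is_eigenvalue_def by blast+
  then show False by simp
qed

text \<open>Since A and R commute and A R^2 = 1, the square of A R is A. Any other candidate B
  commutes with A = B^2, hence with R and with A R, and uniqueness among commuting roots
  applies.\<close>

lemma psqrt_eq_mult_isqrt:
  fixes A :: "complex^'n^'n"
  assumes A: "regular_pencil A"
    and eig: "\<And>lam. is_eigenvalue (A ** isqrt A) lam \<Longrightarrow> 0 < Re lam"
  shows "psqrt A = A ** isqrt A"
proof -
  let ?S = "A ** isqrt A"
  have AR: "A ** isqrt A = isqrt A ** A"
    by (rule isqrt_commute[OF A refl])
  have sq: "?S ** ?S = A"
  proof -
    have "?S ** ?S = A ** isqrt A ** isqrt A ** A"
      by (metis AR matrix_mul_assoc)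
    then show ?thesis by (simp add: mult_isqrt_square[OF A])
  qed
  show ?thesis
    unfolding psqrt_def
  proof (rule the_equality)
    show "?S ** ?S = A \<and> (\<forall>lam. is_eigenvalue ?S lam \<longrightarrow> 0 < Re lam)"
      using sq eig by blast
  next
    fix B assume B: "B ** B = A \<and> (\<forall>lam. is_eigenvalue B lam \<longrightarrow> 0 < Re lam)"
    then have BA: "B ** A = A ** B"
      by (metis matrix_mul_assoc)
    have "B ** ?S = ?S ** B"
      using isqrt_commute[OF A BA] BA by (metis matrix_mul_assoc)
    moreover have "B ** B = ?S ** ?S"
      using B by (simp only: sq)
    ultimately show "B = ?S"
      using B eig commuting_sqrt_unique[of B ?S] by blast
  qed
qed

lemma matrix_inv_mult_isqrt:
  "regular_pencil A \<Longrightarrow> matrix_inv (A ** isqrt A) = isqrt A"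
  by (intro matrix_inv_unique mult_isqrt_square)

section \<open>Sectorial matrices\<close>

definition cform :: "complex^'n^'n \<Rightarrow> complex^'n \<Rightarrow> complex" where
  "cform X v = (\<Sum>i\<in>UNIV. \<Sum>j\<in>UNIV. cnj (v$i) * X$i$j * v$j)"

text \<open>A decomposition of the matrix itself, rather than a cone condition on its form: besides
  the cone it yields that \<open>A\<close> is symmetric, and that it is real when p is real.\<close>

definition sectorial :: "complex \<Rightarrow> complex^'n^'n \<Rightarrow> bool" where
  "sectorial p A \<longleftrightarrow> (\<exists>a b. symS a \<and> symS b \<and> real_posdef a \<and> real_psd b \<and>
     A = cmat_of a + cmat_scale p (cmat_of b))"

lemma cform_mult_vec: "cform X v = (\<Sum>i\<in>UNIV. cnj (v$i) * (X *v v)$i)"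
  by (simp add: cform_def matrix_vector_mult_def sum_distrib_left mult.assoc)

lemma cform_add: "cform (X + Y) v = cform X v + cform Y v"
  by (simp add: cform_def sum.distrib algebra_simps)

lemma cform_cmat_scale: "cform (cmat_scale c X) v = c * cform X v"
  by (simp add: cform_def cmat_scale_def sum_distrib_left mult_ac)

lemma cform_scaleR: "cform (r *\<^sub>R X) v = r *\<^sub>R cform X v"
  by (simp add: cform_def scaleR_sum_right)

lemma bounded_linear_cform: "bounded_linear (\<lambda>X :: complex^'n^'n. cform X v)"
  unfolding linear_conv_bounded_linear[symmetric]
  by (intro linearI cform_add cform_scaleR)

text \<open>The inner product of the real Euclidean structure on complex vectors is the real part of
  the Hermitian product.\<close>

lemma Re_cform: "Re (cform X v) = v \<bullet> (X *v v)"
  by (simp add: cform_mult_vec inner_vec_def inner_complex_def)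

lemma symS_iff: "symS a \<longleftrightarrow> (\<forall>i j. a$i$j = a$j$i)"
  by (auto simp: symS_def transpose_def vec_eq_iff)

text \<open>For v = x + i y the cross terms between x and y cancel because \<open>a\<close> is
  symmetric.\<close>

lemma cform_cmat_of:
  assumes "symS a"
  shows "cform (cmat_of a) v = complex_of_real
           ((\<chi> i. Re (v$i)) \<bullet> (a *v (\<chi> i. Re (v$i))) + (\<chi> i. Im (v$i)) \<bullet> (a *v (\<chi> i. Im (v$i))))"
proof (rule complex_eqI)
  show "Re (cform (cmat_of a) v) = Re (complex_of_real
      ((\<chi> i. Re (v$i)) \<bullet> (a *v (\<chi> i. Re (v$i))) + (\<chi> i. Im (v$i)) \<bullet> (a *v (\<chi> i. Im (v$i)))))"
    by (simp add: cform_def cmat_of_def inner_vec_def matrix_vector_mult_def sum_distrib_left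
        sum.distrib[symmetric] algebra_simps)
  have "(\<Sum>i\<in>UNIV. \<Sum>j\<in>UNIV. Re (v$i) * a$i$j * Im (v$j)) = (\<Sum>i\<in>UNIV. \<Sum>j\<in>UNIV. Im (v$i) * a$i$j * Re (v$j))"
    using assms by (subst sum.swap) (simp add: symS_iff mult_ac)
  then show "Im (cform (cmat_of a) v) = Im (complex_of_real
      ((\<chi> i. Re (v$i)) \<bullet> (a *v (\<chi> i. Re (v$i))) + (\<chi> i. Im (v$i)) \<bullet> (a *v (\<chi> i. Im (v$i)))))"
    by (simp add: cform_def cmat_of_def sum_subtractf algebra_simps)
qed

lemma cform_cmat_of_nonneg:
  assumes "symS b" "real_psd b"
  shows "\<exists>\<beta>\<ge>0. cform (cmat_of b) v = complex_of_real \<beta>"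
  using cform_cmat_of[OF assms(1), of v] assms(2) add_nonneg_nonneg unfolding real_psd_def by blast

lemma cform_cmat_of_pos:
  assumes "symS a" "real_posdef a" "v \<noteq> 0"
  shows "\<exists>\<alpha>>0. cform (cmat_of a) v = complex_of_real \<alpha>"
proof -
  have nonneg: "0 \<le> u \<bullet> (a *v u)" for u
    using assms(2) by (cases "u = 0") (auto simp: real_posdef_def less_imp_le)
  have "(\<chi> i. Re (v$i)) \<noteq> 0 \<or> (\<chi> i. Im (v$i)) \<noteq> 0"
    using assms(3) by (auto simp: vec_eq_iff complex_eq_iff)
  then have "0 < (\<chi> i. Re (v$i)) \<bullet> (a *v (\<chi> i. Re (v$i))) + (\<chi> i. Im (v$i)) \<bullet> (a *v (\<chi> i. Im (v$i)))"
    using assms(2) nonneg unfolding real_posdef_def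
    by (metis add_pos_nonneg add_nonneg_pos)
  then show ?thesis
    using cform_cmat_of[OF assms(1)] by blast
qed

section \<open>The cone spanned by 1 and p for p in the slit plane\<close>

lemma slit_plane_iff: "p \<in> slit_plane \<longleftrightarrow> Im p \<noteq> 0 \<or> 0 < Re p"
proof -
  have "p \<in> complex_of_real ` {..0} \<longleftrightarrow> Im p = 0 \<and> Re p \<le> 0"
    by (auto simp: image_iff complex_eq_iff)
  then show ?thesis by (auto simp: slit_plane_def)
qed

lemma sectorial_form:
  assumes "sectorial p A" "v \<noteq> 0"
  shows "\<exists>\<alpha> \<beta>. 0 < \<alpha> \<and> 0 \<le> \<beta> \<and> cform A v = complex_of_real \<alpha> + p * complex_of_real \<beta>"
proof -
  obtain a b where ab: "symS a" "symS b" "real_posdef a" "real_psd b"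
      "A = cmat_of a + cmat_scale p (cmat_of b)"
    using assms(1) unfolding sectorial_def by blast
  then show ?thesis
    using cform_cmat_of_pos[OF ab(1,3) assms(2)] cform_cmat_of_nonneg[OF ab(2,4), of v]
    by (metis cform_add cform_cmat_scale)
qed

text \<open>If Im p is nonzero, vanishing forces \<beta> = 0 and then \<alpha> = 0; if p is a
  positive real, the sum is positive.\<close>

lemma sector_nonzero:
  assumes "p \<in> slit_plane" "0 < \<alpha>" "0 \<le> \<beta>"
  shows "complex_of_real \<alpha> + p * complex_of_real \<beta> \<noteq> 0"
proof
  assume "complex_of_real \<alpha> + p * complex_of_real \<beta> = 0"
  then have "\<alpha> + Re p * \<beta> = 0" "Im p * \<beta> = 0"
    by (auto simp: complex_eq_iff)
  then show False
    using assms by (auto simp: slit_plane_iff add_pos_nonneg dest: sym)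
       (smt (verit) mult_nonneg_nonneg)
qed

text \<open>The identity is absorbed into the positive definite part, giving the pair t a + s 1 and
  t b. The condition s + t > 0 keeps the first one definite, through \<open>a\<close> when t > 0 and
  through the identity when t = 0.\<close>

lemma sectorial_pencil:
  fixes A :: "complex^'n^'n"
  assumes A: "sectorial p A" and s: "0 \<le> s" and t: "0 \<le> t" and st: "0 < s + t"
  shows "sectorial p (t *\<^sub>R A + s *\<^sub>R mat 1)"
proof -
  obtain a b :: "real^'n^'n" where ab: "symS a" "symS b" "real_posdef a" "real_psd b"
      "A = cmat_of a + cmat_scale p (cmat_of b)"
    using A unfolding sectorial_def by blast
  have "real_posdef (t *\<^sub>R a + s *\<^sub>R mat 1)"
    unfolding real_posdef_def
  proof (intro allI impI)
    fix v :: "real^'n" assume v: "v \<noteq> 0"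
    have 1: "0 < v \<bullet> (a *v v)" "0 < v \<bullet> v"
      using ab(3) v by (auto simp: real_posdef_def)
    have "v \<bullet> ((t *\<^sub>R a + s *\<^sub>R mat 1) *v v) = t * (v \<bullet> (a *v v)) + s * (v \<bullet> v)"
      by (simp add: matrix_vector_mult_add_rdistrib inner_add_right scaleR_matrix_vector_assoc[symmetric])
    moreover have "0 < t * (v \<bullet> (a *v v)) + s * (v \<bullet> v)"
    proof (cases "t = 0")
      case True
      then show ?thesis using st 1 by simp
    next
      case False
      then show ?thesis using s t 1 by (intro add_pos_nonneg mult_pos_pos) auto
    qed
    ultimately show "0 < v \<bullet> ((t *\<^sub>R a + s *\<^sub>R mat 1) *v v)" by simp
  qed
  moreover have "real_psd (t *\<^sub>R b)"
    using ab(4) t by (simp add: real_psd_def scaleR_matrix_vector_assoc[symmetric])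
  moreover have "symS (t *\<^sub>R a + s *\<^sub>R mat 1)" "symS (t *\<^sub>R b)"
    using ab(1,2) by (auto simp: symS_iff mat_def)
  moreover have "t *\<^sub>R A + s *\<^sub>R mat 1
      = cmat_of (t *\<^sub>R a + s *\<^sub>R mat 1) + cmat_scale p (cmat_of (t *\<^sub>R b))"
    by (simp add: ab(5) vec_eq_iff cmat_of_def cmat_scale_def mat_def scaleR_conv_of_real[where 'a=complex]
        algebra_simps complex_eq_iff)
  ultimately show ?thesis
    unfolding sectorial_def by blast
qed

lemma sectorial_invertible:
  assumes A: "sectorial p A" and p: "p \<in> slit_plane"
  shows "invertible (A :: complex^'n^'n)"
proof -
  have "v = 0" if v: "A *v v = 0" for v :: "complex^'n"
  proof (rule ccontr)
    assume "v \<noteq> 0"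
    then have "cform A v \<noteq> 0"
      using sectorial_form[OF A] sector_nonzero[OF p] by metis
    then show False
      by (simp add: cform_mult_vec v)
  qed
  then show ?thesis
    using invertible_left_inverse matrix_left_invertible_ker by blast
qed

lemma sectorial_regular_pencil:
  "sectorial p A \<Longrightarrow> p \<in> slit_plane \<Longrightarrow> regular_pencil A"
  unfolding regular_pencil_def by (blast intro: sectorial_invertible sectorial_pencil)

lemma cform_matrix_inv:
  fixes M :: "complex^'n^'n"
  assumes "invertible M"
  shows "cform (matrix_inv M) v = cnj (cform M (matrix_inv M *v v))"
proof -
  have "M *v (matrix_inv M *v v) = v"
    by (simp add: matrix_vector_mul_assoc matrix_inv_right_left[OF assms])
  then show ?thesis
    by (simp add: cform_mult_vec[of _ v] cform_mult_vec[of M] mult.commute)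
qed

text \<open>At each angle the form of the inverse at v is the conjugate of the form of the arc
  pencil at w = M^(-1) v, hence lies in the cone spanned by 1 and cnj p. The coefficients are
  continuous in the angle, so integrating them gives s and t.\<close>

lemma isqrt_form:
  fixes A :: "complex^'n^'n"
  assumes A: "sectorial p A" and p: "p \<in> slit_plane" and v: "v \<noteq> 0"
  shows "\<exists>s t. 0 < s \<and> 0 \<le> t \<and> cform (isqrt A) v = complex_of_real s + cnj p * complex_of_real t"
proof -
  obtain a b where ab: "symS a" "symS b" "real_posdef a" "real_psd b"
      "A = cmat_of a + cmat_scale p (cmat_of b)"
    using A unfolding sectorial_def by blast
  note pencil = sectorial_regular_pencil[OF A p]
  define w where "w \<phi> = matrix_inv (arc_pencil A \<phi>) *v v" for \<phi>
  define \<alpha> where "\<alpha> \<phi> = (cos \<phi>)\<^sup>2 * Re (cform (cmat_of a) (w \<phi>)) + (sin \<phi>)\<^sup>2 * Re (cform (mat 1) (w \<phi>))" for \<phi>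
  define \<beta> where "\<beta> \<phi> = (cos \<phi>)\<^sup>2 * Re (cform (cmat_of b) (w \<phi>))" for \<phi>
  have w0: "w \<phi> \<noteq> 0" for \<phi>
  proof
    assume "w \<phi> = 0"
    then have "arc_pencil A \<phi> *v (matrix_inv (arc_pencil A \<phi>) *v v) = 0"
      by (simp add: w_def)
    then show False
      using v by (simp add: matrix_vector_mul_assoc matrix_inv_right_left[OF invertible_arc[OF pencil]])
  qed
  have one: "cform (mat 1) u = complex_of_real (u \<bullet> u)" for u :: "complex^'n"
    by (simp add: cform_mult_vec inner_vec_def inner_complex_def complex_eq_iff sum_nonneg)
  have form: "cform (matrix_inv (arc_pencil A \<phi>)) v = complex_of_real (\<alpha> \<phi>) + cnj p * complex_of_real (\<beta> \<phi>)" for \<phi>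
  proof -
    obtain x where x: "cform (cmat_of a) (w \<phi>) = complex_of_real x"
      using cform_cmat_of_pos[OF ab(1,3) w0] by blast
    obtain y where y: "cform (cmat_of b) (w \<phi>) = complex_of_real y"
      using cform_cmat_of_nonneg[OF ab(2,4)] by blast
    have "cform (arc_pencil A \<phi>) (w \<phi>) = complex_of_real (\<alpha> \<phi>) + p * complex_of_real (\<beta> \<phi>)"
      by (simp add: arc_pencil_def cform_add cform_scaleR cform_cmat_scale ab(5) x y one \<alpha>_def \<beta>_def
          complex_eq_iff algebra_simps)
    then show ?thesis
      using cform_matrix_inv[OF invertible_arc[OF pencil], of \<phi> v] by (simp add: w_def)
  qed
  have contw: "continuous_on {0..pi/2} (\<lambda>\<phi>. w \<phi> $ i)" for i
    unfolding w_def matrix_vector_mult_def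
    using continuous_on_inv_arc[OF pencil] by (auto intro!: continuous_intros)
  have cont: "continuous_on {0..pi/2} \<alpha>" "continuous_on {0..pi/2} \<beta>"
    unfolding \<alpha>_def \<beta>_def cform_def by (intro continuous_intros contw)+
  have \<alpha>: "0 < \<alpha> \<phi>" for \<phi>
  proof -
    obtain x where x: "0 < x" "cform (cmat_of a) (w \<phi>) = complex_of_real x"
      using cform_cmat_of_pos[OF ab(1,3) w0] by blast
    have y: "0 < w \<phi> \<bullet> w \<phi>" using w0 by simp
    show ?thesis
    proof (cases "cos \<phi> = 0")
      case True
      then have "sin \<phi> \<noteq> 0"
        using sin_cos_squared_add[of \<phi>] by auto
      then show ?thesis using True y by (simp add: \<alpha>_def one)
    next
      case False
      then show ?thesis using x y by (simp add: \<alpha>_def one add_pos_nonneg)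
    qed
  qed
  have \<beta>: "0 \<le> \<beta> \<phi>" for \<phi>
    using cform_cmat_of_nonneg[OF ab(2,4), of "w \<phi>"] by (auto simp: \<beta>_def)
  \<comment> \<open>Strict positivity of s: the continuous function \<alpha> is positive everywhere
    and attains its minimum on the compact interval, so its integral is at least pi/2 times a
    positive number.\<close>
  have "{0..pi/2} \<noteq> {}" by simp
  then obtain \<phi>0 where \<phi>0: "\<And>\<phi>. \<phi> \<in> {0..pi/2} \<Longrightarrow> \<alpha> \<phi>0 \<le> \<alpha> \<phi>"
    using continuous_attains_inf[OF compact_Icc _ cont(1)] by blast
  note int\<alpha> = integrable_continuous_real[OF cont(1)]
  note int\<beta> = integrable_continuous_real[OF cont(2)]
  have "integral {0..pi/2} (\<lambda>_. \<alpha> \<phi>0) \<le> integral {0..pi/2} \<alpha>"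
    by (intro integral_le int\<alpha> \<phi>0) auto
  moreover have "integral {0..pi/2} (\<lambda>_. \<alpha> \<phi>0) = pi/2 * \<alpha> \<phi>0"
    by simp
  moreover have "0 < pi/2 * \<alpha> \<phi>0"
    using \<alpha>[of \<phi>0] by simp
  ultimately have "0 < integral {0..pi/2} \<alpha>"
    by linarith
  moreover have "0 \<le> integral {0..pi/2} \<beta>"
    by (intro integral_nonneg int\<beta> \<beta>)
  moreover have "cform (isqrt A) v = complex_of_real (2 / pi * integral {0..pi/2} \<alpha>) +
      cnj p * complex_of_real (2 / pi * integral {0..pi/2} \<beta>)"
  proof -
    have "((\<lambda>\<phi>. cform (matrix_inv (arc_pencil A \<phi>)) v) has_integral
        cform (integral {0..pi/2} (\<lambda>\<phi>. matrix_inv (arc_pencil A \<phi>))) v) {0..pi/2}"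
      using has_integral_linear[OF integrable_integral[OF integrable_inv_arc[OF pencil]] bounded_linear_cform]
      by (simp add: o_def)
    moreover have "((\<lambda>\<phi>. complex_of_real (\<alpha> \<phi>) + cnj p * complex_of_real (\<beta> \<phi>)) has_integral
        complex_of_real (integral {0..pi/2} \<alpha>) + cnj p * complex_of_real (integral {0..pi/2} \<beta>)) {0..pi/2}"
      by (intro has_integral_add has_integral_mult_right has_integral_of_real integrable_integral int\<alpha> int\<beta>)
    ultimately have "cform (integral {0..pi/2} (\<lambda>\<phi>. matrix_inv (arc_pencil A \<phi>))) v
      = complex_of_real (integral {0..pi/2} \<alpha>) + cnj p * complex_of_real (integral {0..pi/2} \<beta>)"
      unfolding form by (rule has_integral_unique)
    then have "cform (isqrt A) v = (2 / pi) *\<^sub>R (complex_of_real (integral {0..pi/2} \<alpha>) +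
        cnj p * complex_of_real (integral {0..pi/2} \<beta>))"
      by (simp only: isqrt_def cform_scaleR)
    then show ?thesis
      by (simp add: scaleR_conv_of_real[where 'a = complex] algebra_simps)
  qed
  moreover have "0 < 2 / pi * x" if "0 < x" for x :: real
    using that by simp
  moreover have "0 \<le> 2 / pi * x" if "0 \<le> x" for x :: real
    using that by simp
  ultimately show ?thesis by blast
qed

text \<open>By the first relation Im lam has weakly the sign of Im p; by the second so has Im
  (lam^2) = 2 Re lam Im lam. The first alone would admit an obtuse argument, the second alone would
  admit -lam; together they exclude Re lam < 0.\<close>

lemma Re_pos_of_sectors:
  assumes p: "p \<in> slit_plane" and pos: "0 < s" "0 \<le> t" "0 < \<alpha>" "0 \<le> \<beta>" "0 < N"
    and 1: "lam * (complex_of_real s + cnj p * complex_of_real t) = complex_of_real N"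
    and 2: "lam * lam * complex_of_real N = complex_of_real \<alpha> + p * complex_of_real \<beta>"
  shows "0 < Re lam"
proof -
  define x y u q where "x = Re lam" "y = Im lam" "u = Re p" "q = Im p"
  note defs = this
  have e1: "x * (s + u * t) + y * (q * t) = N" and e2: "y * (s + u * t) = x * (q * t)"
    using 1 by (auto simp: complex_eq_iff defs algebra_simps)
  have e3: "(x * x - y * y) * N = \<alpha> + u * \<beta>" and e4: "2 * x * y * N = q * \<beta>"
    using 2 by (auto simp: complex_eq_iff defs algebra_simps)
  show ?thesis
  proof (cases "q = 0")
    case True
    then have "0 < u" using p by (simp add: slit_plane_iff defs)
    then have "0 < s + u * t" using pos by (simp add: add_pos_nonneg)
    moreover have "0 < x * (s + u * t)" using e1 True pos by simp
    ultimately show ?thesis by (simp add: zero_less_mult_iff defs)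
  next
    case False
    \<comment> \<open>Taking imaginary parts after multiplying the first relation by the conjugate
      of lam: Im lam N = |lam|^2 Im p t.\<close>
    have e5: "y * N = (x * x + y * y) * (q * t)"
    proof -
      have "y * N = x * (y * (s + u * t)) + y * y * (q * t)"
        unfolding e1[symmetric] by (simp add: algebra_simps)
      then show ?thesis unfolding e2 by (simp add: algebra_simps)
    qed
    \<comment> \<open>For purely imaginary lam the imaginary part of the second relation gives
      \<beta> = 0, and its real part then equates a nonpositive number with \<alpha>.\<close>
    have x0: "x \<noteq> 0"
    proof
      assume "x = 0"
      then have "\<beta> = 0" using e4 False by simp
      with \<open>x = 0\<close> e3 have "- (y * y * N) = \<alpha>" by simp
      moreover have "0 \<le> y * y * N" using pos by simp
      ultimately show False using pos by linarith
    qed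
    show ?thesis
    proof (rule ccontr)
      assume "\<not> 0 < Re lam"
      with x0 have x: "x < 0" by (simp add: defs)
      \<comment> \<open>For t = 0 the first relation reads Re lam s = N, which already contradicts
        Re lam < 0. For t > 0, Im lam has strictly the sign of Im p.\<close>
      have "0 < t"
      proof (rule ccontr)
        assume "\<not> 0 < t"
        with pos have "t = 0" by simp
        with e1 have "x * s = N" by simp
        moreover have "x * s < 0" using x pos(1) by (rule mult_neg_pos)
        ultimately show False using pos by linarith
      qed
      have "0 < (x * x + y * y) * t * (q * q)"
      proof -
        have "0 < x * x" and q: "0 < q * q" and "0 \<le> y * y"
          using x False by (simp_all add: mult_neg_neg zero_less_mult_iff) linarith
        then have "0 < x * x + y * y" by linarith
        then show ?thesis by (rule mult_pos_pos[OF mult_pos_pos[OF _ \<open>0 < t\<close>] q])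
      qed
      also have "(x * x + y * y) * t * (q * q) = q * (y * N)"
        unfolding e5 by (simp add: algebra_simps)
      finally have "0 < q * y * N" by (simp add: mult.assoc)
      then have "x * (q * y * N) < 0" using x by (rule mult_neg_pos[rotated])
      moreover have "2 * (x * (q * y * N)) = q * q * \<beta>" using e4 by (simp add: algebra_simps)
      moreover have "0 \<le> q * q * \<beta>" using pos by simp
      ultimately show False by linarith
    qed
  qed
qed

text \<open>An eigenvector w of A R satisfies lam R w = w and A w = lam^2 w. Evaluating the forms of
  R and of A at this same w puts N / lam and lam^2 N, with N = |w|^2, into the two cones.\<close>

lemma sectorial_eigenvalue:
  fixes A :: "complex^'n^'n"
  assumes A: "sectorial p A" and p: "p \<in> slit_plane" and eig: "is_eigenvalue (A ** isqrt A) lam"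
  shows "0 < Re lam"
proof -
  note pencil = sectorial_regular_pencil[OF A p]
  obtain w where w: "w \<noteq> 0" "(A ** isqrt A) *v w = lam *s w"
    using eig unfolding is_eigenvalue_def by blast
  have AR: "A ** isqrt A = isqrt A ** A"
    by (rule isqrt_commute[OF pencil refl])
  have "isqrt A *v ((A ** isqrt A) *v w) = w"
    using mult_isqrt_square[OF pencil] unfolding matrix_vector_mul_assoc
    by (simp add: matrix_mul_assoc AR[symmetric])
  then have 1: "lam *s (isqrt A *v w) = w"
    by (simp add: w(2) vec.scale)
  have "(A ** isqrt A) ** (A ** isqrt A) = A"
    by (metis AR matrix_mul_assoc mult_isqrt_square[OF pencil] matrix_mul_lid)
  then have "A *v w = (A ** isqrt A) *v ((A ** isqrt A) *v w)"
    by (simp add: matrix_vector_mul_assoc)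
  also have "\<dots> = (lam * lam) *s w"
    by (simp add: w(2) vec.scale)
  finally have 2: "A *v w = (lam * lam) *s w" .
  have N: "(\<Sum>i\<in>UNIV. cnj (w$i) * w$i) = complex_of_real (w \<bullet> w)"
    by (simp add: inner_vec_def inner_complex_def complex_eq_iff)
  have "lam * cform (isqrt A) w = (\<Sum>i\<in>UNIV. cnj (w$i) * (lam *s (isqrt A *v w))$i)"
    by (simp add: cform_mult_vec sum_distrib_left mult_ac)
  then have f1: "lam * cform (isqrt A) w = complex_of_real (w \<bullet> w)"
    unfolding 1 N .
  have f2: "cform A w = lam * lam * complex_of_real (w \<bullet> w)"
    unfolding N[symmetric] by (simp add: cform_mult_vec 2 sum_distrib_left mult_ac)
  obtain s t where st: "0 < s" "0 \<le> t" "cform (isqrt A) w = complex_of_real s + cnj p * complex_of_real t"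
    using isqrt_form[OF A p w(1)] by blast
  obtain \<alpha> \<beta> where ab: "0 < \<alpha>" "0 \<le> \<beta>" "cform A w = complex_of_real \<alpha> + p * complex_of_real \<beta>"
    using sectorial_form[OF A w(1)] by blast
  have "0 < w \<bullet> w" using w(1) by simp
  then show ?thesis
    using Re_pos_of_sectors[OF p st(1,2) ab(1,2) _ f1[unfolded st(3)] f2[symmetric, unfolded ab(3)]] by blast
qed

lemma matrix_inv_psqrt:
  assumes "sectorial p A" "p \<in> slit_plane"
  shows "matrix_inv (psqrt A) = isqrt A"
  using psqrt_eq_mult_isqrt matrix_inv_mult_isqrt sectorial_regular_pencil[OF assms]
    sectorial_eigenvalue[OF assms] by metis

section \<open>Regularity of the inverse square root\<close>

lemma has_integral_isqrt_entry:
  fixes A :: "complex^'n^'n"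
  assumes "regular_pencil A"
  shows "((\<lambda>\<phi>. (2 / pi) *\<^sub>R matrix_inv (arc_pencil A \<phi>) $ i $ j) has_integral isqrt A $ i $ j) {0..pi/2}"
proof -
  have "bounded_linear (\<lambda>X :: complex^'n^'n. (2 / pi) *\<^sub>R X $ i $ j)"
    by (intro bounded_linear_const_scaleR bounded_linear_compose[OF bounded_linear_vec_nth bounded_linear_vec_nth])
  from has_integral_linear[OF integrable_integral[OF integrable_inv_arc[OF assms]] this]
  show ?thesis by (simp add: o_def isqrt_def)
qed

section \<open>Symmetry, reality, size and holomorphy of the inverse root\<close>

lemma transpose_matrix_inv:
  fixes A :: "complex^'n^'n"
  assumes "invertible A" "transpose A = A"
  shows "transpose (matrix_inv A) = matrix_inv A"
proof (rule matrix_inv_unique[symmetric])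
  have "A ** transpose (matrix_inv A) = transpose (matrix_inv A ** A)"
    by (simp add: matrix_transpose_mul assms(2))
  then show "A ** transpose (matrix_inv A) = mat 1"
    by (simp add: matrix_inv_right_left[OF assms(1)])
qed

lemma isqrt_symmetric:
  fixes A :: "complex^'n^'n"
  assumes A: "regular_pencil A" and sym: "transpose A = A"
  shows "isqrt A $ i $ j = isqrt A $ j $ i"
proof (rule has_integral_unique[OF has_integral_isqrt_entry[OF A]])
  have "transpose (arc_pencil A \<phi>) = arc_pencil A \<phi>" for \<phi>
    using sym by (simp add: arc_pencil_def transpose_def vec_eq_iff mat_def)
  then have "transpose (matrix_inv (arc_pencil A \<phi>)) = matrix_inv (arc_pencil A \<phi>)" for \<phi>
    by (intro transpose_matrix_inv invertible_arc A)
  then have "matrix_inv (arc_pencil A \<phi>) $ i $ j = matrix_inv (arc_pencil A \<phi>) $ j $ i" for \<phi>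
    by (simp add: transpose_def vec_eq_iff)
  then show "((\<lambda>\<phi>. (2 / pi) *\<^sub>R matrix_inv (arc_pencil A \<phi>) $ i $ j) has_integral isqrt A $ j $ i) {0..pi/2}"
    using has_integral_isqrt_entry[OF A, of j i] by simp
qed

text \<open>The entrywise conjugate of the inverse is again a right inverse of the real matrix
  \<open>A\<close>, so it equals the inverse.\<close>

lemma matrix_inv_real:
  fixes A :: "complex^'n^'n"
  assumes A: "invertible A" and real: "\<And>i j. A $ i $ j \<in> \<real>"
  shows "matrix_inv A $ i $ j \<in> \<real>"
proof -
  let ?B = "(\<chi> i j. cnj (matrix_inv A $ i $ j)) :: complex^'n^'n"
  have "(A ** ?B) $ i $ j = cnj ((A ** matrix_inv A) $ i $ j)" for i j
    using real by (simp add: matrix_matrix_mult_def Reals_cnj_iff)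
  then have "A ** ?B = mat 1"
    by (simp add: vec_eq_iff matrix_inv_right_left[OF A] mat_def)
  then have "matrix_inv A = ?B"
    by (rule matrix_inv_unique)
  then have "matrix_inv A $ i $ j = cnj (matrix_inv A $ i $ j)"
    by (metis (no_types, lifting) vec_lambda_beta)
  then show ?thesis
    by (simp add: Reals_cnj_iff)
qed

lemma isqrt_real:
  fixes A :: "complex^'n^'n"
  assumes A: "regular_pencil A" and real: "\<And>i j. A $ i $ j \<in> \<real>"
  shows "isqrt A $ i $ j \<in> \<real>"
proof -
  have "arc_pencil A \<phi> $ i $ j \<in> \<real>" for \<phi> i j
    using real[of i j] by (simp add: arc_pencil_def mat_def scaleR_conv_of_real[where 'a = complex])
  then have "matrix_inv (arc_pencil A \<phi>) $ i $ j \<in> \<real>" for \<phi>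
    by (intro matrix_inv_real invertible_arc A)
  then have "Im (matrix_inv (arc_pencil A \<phi>) $ i $ j) = 0" for \<phi>
    by (simp add: complex_is_Real_iff)
  then have "((\<lambda>\<phi>. 0) has_integral Im (isqrt A $ i $ j)) {0..pi/2}"
    using has_integral_linear[OF has_integral_isqrt_entry[OF A, of i j] bounded_linear_Im]
    by (simp add: o_def)
  then have "Im (isqrt A $ i $ j) = 0"
    by (metis has_integral_0 has_integral_unique)
  then show ?thesis
    by (simp add: complex_is_Real_iff)
qed

text \<open>Because \<gamma> \<le> 1, the identity is coercive with the same constant, hence so is
  every arc pencil M. From M w = e_j one gets \<gamma> |w|^2 \<le> |w|, which bounds the j-th column
  of the inverse. The weight \<open>2 / pi\<close> makes the integral an average over the arc, so
  the bound is kept.\<close>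

lemma norm_isqrt_entry_le:
  fixes A :: "complex^'n^'n"
  assumes A: "regular_pencil A" and g: "0 < \<gamma>" "\<gamma> \<le> 1"
    and coercive: "\<And>w. \<gamma> * (w \<bullet> w) \<le> Re (cform A w)"
  shows "norm (isqrt A $ i $ j) \<le> 1 / \<gamma>"
proof -
  have bound: "norm (matrix_inv (arc_pencil A \<phi>) $ i $ j) \<le> 1 / \<gamma>" for \<phi>
  proof -
    let ?M = "arc_pencil A \<phi>"
    define w where "w = matrix_inv ?M *v axis j 1"
    have Mw: "?M *v w = axis j 1"
      by (simp add: w_def matrix_vector_mul_assoc matrix_inv_right_left[OF invertible_arc[OF A]])
    have wi: "w $ i = matrix_inv ?M $ i $ j"
      by (simp add: w_def matrix_vector_mult_def axis_def if_distrib cong: if_cong)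
    have "\<gamma> * (w \<bullet> w) = (cos \<phi>)\<^sup>2 * (\<gamma> * (w \<bullet> w)) + (sin \<phi>)\<^sup>2 * (\<gamma> * (w \<bullet> w))"
      by (metis distrib_right mult_1 sin_cos_squared_add2)
    also have "\<dots> \<le> (cos \<phi>)\<^sup>2 * Re (cform A w) + (sin \<phi>)\<^sup>2 * (w \<bullet> w)"
      using g by (intro add_mono mult_left_mono coercive) (auto simp: mult_left_le_one_le)
    also have "\<dots> = Re (cform ?M w)"
      by (simp add: arc_pencil_def cform_add cform_scaleR Re_cform[of "mat 1"])
    also have "\<dots> = w \<bullet> axis j 1"
      by (simp add: Re_cform Mw)
    also have "\<dots> \<le> norm w"
      using norm_cauchy_schwarz[of w "axis j 1"] by simp
    finally have "\<gamma> * norm w * norm w \<le> norm w"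
      by (simp add: dot_square_norm power2_eq_square mult.assoc)
    then have "norm w \<le> 1 / \<gamma>"
      using g by (cases "w = 0") (auto simp: field_simps)
    then show ?thesis
      using Finite_Cartesian_Product.norm_nth_le[of w i] unfolding wi by linarith
  qed
  have "norm (isqrt A $ i $ j) \<le> (2 / pi * (1 / \<gamma>)) * measure lborel (cbox 0 (pi/2))"
  proof (rule has_integral_bound)
    show "((\<lambda>\<phi>. (2 / pi) *\<^sub>R matrix_inv (arc_pencil A \<phi>) $ i $ j) has_integral isqrt A $ i $ j) (cbox 0 (pi/2))"
      using has_integral_isqrt_entry[OF A] by simp
    show "norm ((2 / pi) *\<^sub>R matrix_inv (arc_pencil A \<phi>) $ i $ j) \<le> 2 / pi * (1 / \<gamma>)" for \<phi>
      using bound[of \<phi>] by (simp only: norm_scaleR) (intro mult_mono, auto)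
  qed (use g in auto)
  then show ?thesis by simp
qed

text \<open>Differentiation under the integral sign. The Leibniz rule is applied on a convex domain,
  so the argument is carried out on a ball around each point of the open set; continuity of the
  derived integrand comes from that of the derivative of Q.\<close>

lemma holomorphic_isqrt:
  fixes Q :: "complex \<Rightarrow> complex^'n^'n"
  assumes S: "open S" and Q: "\<And>i j. (\<lambda>z. Q z $ i $ j) holomorphic_on S"
    and pencil: "\<And>z. z \<in> S \<Longrightarrow> regular_pencil (Q z)"
  shows "(\<lambda>z. isqrt (Q z) $ i $ j) holomorphic_on S"
proof -
  define Q' where "Q' z = (\<chi> i j. deriv (\<lambda>z. Q z $ i $ j) z)" for z
  define Y where "Y z \<phi> = matrix_inv (arc_pencil (Q z) \<phi>)" for z \<phi>
  let ?dY = "\<lambda>z \<phi>. - (Y z \<phi> ** ((cos \<phi>)\<^sup>2 *\<^sub>R Q' z) ** Y z \<phi>)"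
  have "continuous_on S (\<lambda>z. \<chi> i j. Q z $ i $ j)"
    by (intro continuous_on_vec_lambda holomorphic_on_imp_continuous_on Q)
  then have contQ: "continuous_on S Q"
    by simp
  have contQ': "continuous_on S Q'"
    unfolding Q'_def
    by (intro continuous_on_vec_lambda holomorphic_on_imp_continuous_on holomorphic_deriv Q S)
  have "(\<lambda>z. isqrt (Q z) $ i $ j) field_differentiable at z0 within S" if z0: "z0 \<in> S" for z0
  proof -
    obtain e where e: "e > 0" "ball z0 e \<subseteq> S"
      using S z0 open_contains_ball by blast
    let ?U = "ball z0 e"
    have comp: "continuous_on (?U \<times> cbox 0 (pi/2)) (\<lambda>x. f (fst x))" if "continuous_on S f"
      for f :: "complex \<Rightarrow> complex^'n^'n"
      using e(2) by (intro continuous_on_compose2[OF that continuous_on_fst[OF continuous_on_id]]) auto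
    have contY: "continuous_on (?U \<times> cbox 0 (pi/2)) (\<lambda>x. Y (fst x) (snd x))"
      unfolding Y_def
    proof (intro continuous_on_matrix_inv invertible_arc pencil)
      show "continuous_on (?U \<times> cbox 0 (pi/2)) (\<lambda>x. arc_pencil (Q (fst x)) (snd x))"
        unfolding arc_pencil_def by (intro continuous_intros comp[OF contQ])
    qed (use e in auto)
    have contdY: "continuous_on (?U \<times> cbox 0 (pi/2)) (\<lambda>x. ?dY (fst x) (snd x))"
      by (intro continuous_intros matrix_mult.continuous_on contY comp[OF contQ'])
    have "(\<lambda>z. integral (cbox 0 (pi/2)) (\<lambda>\<phi>. Y z \<phi> $ i $ j)) holomorphic_on ?U"
    proof (rule leibniz_rule_holomorphic)
      fix z \<phi> assume z: "z \<in> ?U"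
      show "((\<lambda>z. Y z \<phi> $ i $ j) has_field_derivative ?dY z \<phi> $ i $ j) (at z within ?U)"
        unfolding Y_def vector_uminus_component
      proof (rule has_field_derivative_matrix_inv)
        fix a b
        have "((\<lambda>z. Q z $ a $ b) has_field_derivative Q' z $ a $ b) (at z within ?U)"
          using holomorphic_derivI[OF Q S, of z] z e(2)
          by (auto simp: Q'_def intro: has_field_derivative_at_within)
        then have "((\<lambda>z. complex_of_real ((cos \<phi>)\<^sup>2) * Q z $ a $ b + ((sin \<phi>)\<^sup>2 *\<^sub>R mat 1 :: complex^'n^'n) $ a $ b)
            has_field_derivative complex_of_real ((cos \<phi>)\<^sup>2) * Q' z $ a $ b + 0) (at z within ?U)"
          by (intro DERIV_add DERIV_cmult DERIV_const)
        then show "((\<lambda>z. arc_pencil (Q z) \<phi> $ a $ b) has_field_derivative ((cos \<phi>)\<^sup>2 *\<^sub>R Q' z) $ a $ b) (at z within ?U)"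
          by (simp add: arc_pencil_def scaleR_conv_of_real[where 'a = complex])
      qed (use z e in \<open>auto intro!: invertible_arc pencil\<close>)
    next
      fix z assume z: "z \<in> ?U"
      show "(\<lambda>\<phi>. Y z \<phi> $ i $ j) integrable_on cbox 0 (pi/2)"
        unfolding Y_def using z e(2)
        by (intro integrable_continuous continuous_intros continuous_on_inv_arc pencil) auto
    next
      show "continuous_on (?U \<times> cbox 0 (pi/2)) (\<lambda>(z, \<phi>). ?dY z \<phi> $ i $ j)"
        using continuous_on_component[OF continuous_on_component[OF contdY]] by (simp add: case_prod_beta)
    qed (rule convex_ball)
    then have "(\<lambda>z. (2 / pi) *\<^sub>R integral (cbox 0 (pi/2)) (\<lambda>\<phi>. Y z \<phi> $ i $ j)) holomorphic_on ?U"
      unfolding scaleR_conv_of_real by (intro holomorphic_intros)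
    moreover have "(2 / pi) *\<^sub>R integral (cbox 0 (pi/2)) (\<lambda>\<phi>. Y z \<phi> $ i $ j) = isqrt (Q z) $ i $ j"
      if "z \<in> ?U" for z
    proof -
      have "Y z integrable_on {0..pi/2}"
        unfolding Y_def[abs_def] using that e(2) by (intro integrable_inv_arc pencil) auto
      moreover have "bounded_linear (\<lambda>X :: complex^'n^'n. X $ i $ j)"
        by (rule bounded_linear_compose[OF bounded_linear_vec_nth bounded_linear_vec_nth])
      ultimately have "((\<lambda>\<phi>. Y z \<phi> $ i $ j) has_integral integral {0..pi/2} (Y z) $ i $ j) {0..pi/2}"
        using has_integral_linear[OF integrable_integral] by (force simp: o_def)
      then show ?thesis
        by (simp add: isqrt_def Y_def[abs_def] integral_unique)
    qed
    ultimately have "(\<lambda>z. isqrt (Q z) $ i $ j) holomorphic_on ?U"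
      by (rule holomorphic_transform)
    then show ?thesis
      using e(1) by (metis centre_in_ball field_differentiable_at_within holomorphic_on_imp_differentiable_at open_ball)
  qed
  then show ?thesis
    by (simp add: holomorphic_on_def)
qed

section \<open>Stieltjes integrals of matrix-valued measures\<close>

text \<open>The kernel 1 / (p + r) is thus bounded uniformly in r, which is behind the domination
  arguments below. The bound is Re p for real p and |Im p| otherwise.\<close>

lemma slit_plane_dist:
  assumes "p \<in> slit_plane"
  shows "\<exists>\<delta>>0. \<forall>r\<ge>0. \<delta> \<le> cmod (p + complex_of_real r)"
proof (cases "Im p = 0")
  case True
  then have "0 < Re p" using assms by (simp add: slit_plane_iff)
  moreover have "Re p \<le> cmod (p + complex_of_real r)" if "0 \<le> r" for r
    using complex_Re_le_cmod[of "p + complex_of_real r"] that by simp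
  ultimately show ?thesis by blast
next
  case False
  moreover have "\<bar>Im p\<bar> \<le> cmod (p + complex_of_real r)" for r
    using abs_Im_le_cmod[of "p + complex_of_real r"] by simp
  ultimately show ?thesis
    by (intro exI[of _ "\<bar>Im p\<bar>"]) auto
qed

lemma open_slit_plane: "open slit_plane"
proof -
  have "slit_plane = {z. Im z < 0} \<union> {z. 0 < Im z} \<union> {z. 0 < Re z}"
    by (auto simp: slit_plane_iff)
  moreover have "open \<dots>"
    by (intro open_Un open_halfspace_Im_lt open_halfspace_Im_gt open_halfspace_Re_gt)
  ultimately show ?thesis by simp
qed

text \<open>The difference quotient is estimated directly: after subtracting the linear term the
  integrand equals g (z - p)^2 / ((z + \<xi>) (p + \<xi>)^2), which is bounded by a constant times
  |z - p|^2 and integrated against a finite measure.\<close>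

lemma (in finite_measure) holomorphic_stieltjes:
  fixes g \<xi> :: "'a \<Rightarrow> real"
  assumes g [measurable]: "g \<in> borel_measurable M" and \<xi> [measurable]: "\<xi> \<in> borel_measurable M"
    and gC: "AE r in M. \<bar>g r\<bar> \<le> C" and \<xi>0: "AE r in M. 0 \<le> \<xi> r"
  shows "(\<lambda>p. LINT r|M. complex_of_real (g r) / (p + complex_of_real (\<xi> r))) holomorphic_on slit_plane"
proof (rule holomorphic_onI)
  fix p assume "p \<in> slit_plane"
  then obtain \<delta> where \<delta>: "0 < \<delta>" "\<And>r. 0 \<le> r \<Longrightarrow> \<delta> \<le> cmod (p + complex_of_real r)"
    using slit_plane_dist by blast
  let ?f = "\<lambda>z r. complex_of_real (g r) / (z + complex_of_real (\<xi> r))"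
  let ?d = "\<lambda>r. complex_of_real (g r) / (p + complex_of_real (\<xi> r))\<^sup>2"
  let ?D = "- (LINT r|M. ?d r)"
  \<comment> \<open>On the disc of radius \<delta> / 2 around p at least half of the distance
    \<delta> is left.\<close>
  have lower: "\<delta> / 2 \<le> cmod (z + complex_of_real r)" if "cmod (z - p) < \<delta> / 2" "0 \<le> r" for z r
    using norm_triangle_ineq4[of "z + complex_of_real r" "z - p"] \<delta>(2)[OF that(2)] that(1)
    by (simp add: algebra_simps)
  have int: "integrable M (?f z)" if "cmod (z - p) < \<delta> / 2" for z
  proof (rule integrable_const_bound)
    show "AE r in M. cmod (?f z r) \<le> C / (\<delta> / 2)"
      using gC \<xi>0
    proof eventually_elim
      case (elim r)
      then show ?case
        unfolding norm_divide norm_of_real using lower[OF that] \<delta>(1) by (intro frac_le) auto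
    qed
  qed measurable
  have intd: "integrable M ?d"
  proof (rule integrable_const_bound)
    show "AE r in M. cmod (?d r) \<le> C / \<delta>\<^sup>2"
      using gC \<xi>0
    proof eventually_elim
      case (elim r)
      then show ?case
        unfolding norm_divide norm_of_real norm_power using \<delta> by (intro frac_le power_mono) auto
    qed
  qed measurable
  have bound: "cmod ((LINT r|M. ?f z r) - (LINT r|M. ?f p r) - ?D * (z - p))
      \<le> (C / (\<delta> / 2 * \<delta>\<^sup>2) * measure M (space M)) * (cmod (z - p))\<^sup>2" if z: "cmod (z - p) < \<delta> / 2" for z
  proof -
    \<comment> \<open>The centre is itself a point of the disc, so that \<open>int\<close> also
      gives integrability at p.\<close>
    have p: "cmod (p - p) < \<delta> / 2" using \<delta>(1) by simp
    have eq: "(LINT r|M. ?f z r) - (LINT r|M. ?f p r) - ?D * (z - p)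
        = (LINT r|M. ?f z r - ?f p r + ?d r * (z - p))"
      by (simp only: Bochner_Integration.integral_add[OF Bochner_Integration.integrable_diff[OF int[OF z] int[OF p]]
            integrable_mult_left[OF intd]] Bochner_Integration.integral_diff[OF int[OF z] int[OF p]]
          integral_mult_left_zero minus_mult_left[symmetric] diff_minus_eq_add)
    have "cmod ((LINT r|M. ?f z r) - (LINT r|M. ?f p r) - ?D * (z - p))
        \<le> (LINT r|M. cmod (?f z r - ?f p r + ?d r * (z - p)))"
      unfolding eq by (rule integral_norm_bound)
    also have "\<dots> \<le> (LINT r|M. C / (\<delta> / 2 * \<delta>\<^sup>2) * (cmod (z - p))\<^sup>2)"
    proof (rule integral_mono_AE)
      show "integrable M (\<lambda>r. cmod (?f z r - ?f p r + ?d r * (z - p)))"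
      proof (rule integrable_norm, rule Bochner_Integration.integrable_add, rule Bochner_Integration.integrable_diff)
        show "integrable M (?f z)" by (rule int[OF z])
        show "integrable M (?f p)" by (rule int[OF p])
        show "integrable M (\<lambda>r. ?d r * (z - p))" by (rule integrable_mult_left[OF intd])
      qed
      show "AE r in M. cmod (?f z r - ?f p r + ?d r * (z - p)) \<le> C / (\<delta> / 2 * \<delta>\<^sup>2) * (cmod (z - p))\<^sup>2"
        using gC \<xi>0
      proof eventually_elim
        case (elim r)
        let ?z = "z + complex_of_real (\<xi> r)" and ?p = "p + complex_of_real (\<xi> r)"
        have pos: "\<delta> / 2 \<le> cmod ?z" "\<delta> \<le> cmod ?p" "0 < cmod ?z" "0 < cmod ?p"
          using lower[OF z elim(2)] \<delta>(2)[OF elim(2)] \<delta>(1) by linarith+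
        then have z0: "?z \<noteq> 0" "?p \<noteq> 0"
          by (simp_all only: zero_less_norm_iff not_False_eq_True)
        have zp: "z - p = ?z - ?p" by simp
        have "g' / Z - g' / P + g' / P\<^sup>2 * (Z - P) = g' * (Z - P)\<^sup>2 / (Z * P\<^sup>2)"
          if "Z \<noteq> 0" "P \<noteq> 0" for g' Z P :: complex
        proof -
          have "g' / Z = g' * P\<^sup>2 / (Z * P\<^sup>2)" "g' / P = g' * (Z * P) / (Z * P\<^sup>2)"
              "g' / P\<^sup>2 * (Z - P) = g' * (Z * (Z - P)) / (Z * P\<^sup>2)"
            using that by (simp_all add: power2_eq_square)
          moreover have "g' * P\<^sup>2 - g' * (Z * P) + g' * (Z * (Z - P)) = g' * (Z - P)\<^sup>2"
            by (simp add: power2_eq_square algebra_simps)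
          ultimately show ?thesis
            by (simp only: add_divide_distrib[symmetric] diff_divide_distrib[symmetric])
        qed
        from this[OF z0, of "complex_of_real (g r)"]
        have "?f z r - ?f p r + ?d r * (z - p) = complex_of_real (g r) * (z - p)\<^sup>2 / (?z * ?p\<^sup>2)"
          unfolding zp .
        then have "cmod (?f z r - ?f p r + ?d r * (z - p)) = \<bar>g r\<bar> / (cmod ?z * (cmod ?p)\<^sup>2) * (cmod (z - p))\<^sup>2"
          by (simp add: norm_divide norm_mult norm_power)
        also have "\<dots> \<le> C / (\<delta> / 2 * \<delta>\<^sup>2) * (cmod (z - p))\<^sup>2"
          using elim(1) \<delta>(1) pos
          by (intro mult_right_mono frac_le mult_mono power_mono mult_pos_pos zero_less_power) auto
        finally show ?case .
      qed
    qed simp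
    finally show ?thesis by (simp add: mult_ac)
  qed
  have "((\<lambda>z. ((LINT r|M. ?f z r) - (LINT r|M. ?f p r)) / (z - p) - ?D) \<longlongrightarrow> 0) (at p)"
  proof (rule Lim_null_comparison)
    let ?K = "C / (\<delta> / 2 * \<delta>\<^sup>2) * measure M (space M)"
    show "((\<lambda>z. ?K * cmod (z - p)) \<longlongrightarrow> 0) (at p)"
      by (rule tendsto_mult_right_zero) (auto intro!: tendsto_eq_intros)
    have "\<forall>\<^sub>F z in at p. z \<noteq> p \<and> cmod (z - p) < \<delta> / 2"
      unfolding eventually_at dist_norm
      by (rule exI[of _ "\<delta> / 2"]) (use \<delta>(1) in simp)
    then show "\<forall>\<^sub>F z in at p. cmod (((LINT r|M. ?f z r) - (LINT r|M. ?f p r)) / (z - p) - ?D) \<le> ?K * cmod (z - p)"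
    proof eventually_elim
      case (elim z)
      then have "((LINT r|M. ?f z r) - (LINT r|M. ?f p r)) / (z - p) - ?D
          = ((LINT r|M. ?f z r) - (LINT r|M. ?f p r) - ?D * (z - p)) / (z - p)"
        by (intro divide_diff_eq_iff) simp
      then have "cmod (((LINT r|M. ?f z r) - (LINT r|M. ?f p r)) / (z - p) - ?D)
          = cmod ((LINT r|M. ?f z r) - (LINT r|M. ?f p r) - ?D * (z - p)) / cmod (z - p)"
        by (simp only: norm_divide)
      also have "\<dots> \<le> ?K * (cmod (z - p))\<^sup>2 / cmod (z - p)"
        using bound[of z] elim by (intro divide_right_mono) auto
      also have "\<dots> = ?K * cmod (z - p)"
        using elim by (simp add: power2_eq_square)
      finally show ?case .
    qed
  qed
  then have "((\<lambda>z. LINT r|M. ?f z r) has_field_derivative ?D) (at p)"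
    by (simp only: has_field_derivative_iff LIM_zero_iff)
  then show "(\<lambda>z. LINT r|M. ?f z r) field_differentiable at p within slit_plane"
    using field_differentiable_at_within field_differentiable_def by blast
qed

text \<open>The form attains a positive minimum on the compact unit sphere, and homogeneity extends
  the estimate to all vectors.\<close>

lemma real_posdef_coercive:
  fixes G :: "real^'n^'n"
  assumes "real_posdef G"
  shows "\<exists>\<gamma>>0. \<gamma> \<le> 1 \<and> (\<forall>v. \<gamma> * (v \<bullet> v) \<le> v \<bullet> (G *v v))"
proof -
  have cont: "continuous_on (sphere 0 1) (\<lambda>v. v \<bullet> (G *v v))"
    by (intro continuous_intros linear_continuous_on matrix_vector_mul_bounded_linear)
  have "sphere (0 :: real^'n) 1 \<noteq> {}"
    using norm_axis_1 by (metis empty_iff mem_sphere_0)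
  then obtain v0 where v0: "norm v0 = 1" "\<And>v. norm v = 1 \<Longrightarrow> v0 \<bullet> (G *v v0) \<le> v \<bullet> (G *v v)"
    using continuous_attains_inf[OF compact_sphere _ cont] by (metis mem_sphere_0)
  \<comment> \<open>Capping at 1 lets the same constant serve for the identity in the arc
    pencil.\<close>
  define \<gamma> where "\<gamma> = min 1 (v0 \<bullet> (G *v v0))"
  have "v0 \<noteq> 0" using v0(1) by auto
  then have "0 < \<gamma>"
    using assms by (simp add: \<gamma>_def real_posdef_def)
  moreover have "\<gamma> * (v \<bullet> v) \<le> v \<bullet> (G *v v)" for v
  proof (cases "v = 0")
    case False
    define u where "u = (1 / norm v) *\<^sub>R v"
    have v: "v = norm v *\<^sub>R u" and u: "norm u = 1"
      using False by (simp_all add: u_def)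
    have "\<gamma> \<le> u \<bullet> (G *v u)"
      using v0(2)[OF u] by (simp add: \<gamma>_def)
    then have "(norm v)\<^sup>2 * \<gamma> \<le> (norm v)\<^sup>2 * (u \<bullet> (G *v u))"
      by (rule mult_left_mono) simp
    also have "\<dots> = v \<bullet> (G *v v)"
      by (subst (2 3) v) (simp add: matrix_vector_mult_scaleR power2_eq_square)
    finally show ?thesis
      by (simp add: dot_square_norm mult.commute)
  qed simp
  ultimately show ?thesis
    by (intro exI[of _ \<gamma>]) (auto simp: \<gamma>_def)
qed

text \<open>The setting after contraction with the unit vector, with no tensors left.
  \<open>N\<close> will be the completion of a Borel measure, whose sigma-algebra may be larger than
  the Borel one; this is why the space and the measurability of the identity are assumed in place of
  an equation for \<open>sets N\<close>.\<close>

locale psd_matrix_measure = finite_measure N for N :: "real measure" +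
  fixes h :: "real \<Rightarrow> real^'n^'n" and C :: real
  assumes h_measurable [measurable]: "\<And>i j. (\<lambda>r. h r $ i $ j) \<in> borel_measurable N"
    and space_UNIV: "space N = UNIV"
    and id_measurable: "(\<lambda>r. r) \<in> borel_measurable N"
    and nonneg_support: "AE r in N. 0 \<le> r"
    and h_sym: "AE r in N. symS (h r)"
    and h_psd: "AE r in N. real_psd (h r)"
    and h_bounded: "AE r in N. \<forall>i j. \<bar>h r $ i $ j\<bar> \<le> C"
    and atom_posdef: "real_posdef (measure N {0} *\<^sub>R h 0)"
begin

definition stieltjes :: "complex \<Rightarrow> complex^'n^'n" where
  "stieltjes p = (\<chi> i j. p * (LINT r|N. complex_of_real (h r $ i $ j) / (p + complex_of_real r)))"

text \<open>Common shape of the two real coefficients of \<open>stieltjes p\<close> and, for p = x >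
  0, of \<open>stieltjes p\<close> itself with weight x / (x + r).\<close>

definition weighted :: "(real \<Rightarrow> real) \<Rightarrow> real^'n^'n" where
  "weighted u = (\<chi> i j. LINT r|N. u r * h r $ i $ j)"

lemma integrable_weighted:
  assumes u: "u \<in> borel_measurable N" and bdd: "AE r in N. \<bar>u r\<bar> \<le> B"
  shows "integrable N (\<lambda>r. u r * h r $ i $ j)"
proof (rule integrable_const_bound)
  show "AE r in N. norm (u r * h r $ i $ j) \<le> B * C"
    using bdd h_bounded
  proof eventually_elim
    case (elim r)
    then show ?case
      unfolding real_norm_def abs_mult by (intro mult_mono) (auto intro: order_trans[OF abs_ge_zero])
  qed
qed (use u in measurable)

lemma symS_weighted:
  assumes u: "u \<in> borel_measurable N"
  shows "symS (weighted u)"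
  unfolding symS_iff weighted_def
proof (intro allI)
  fix i j
  have "AE r in N. u r * h r $ i $ j = u r * h r $ j $ i"
    using h_sym by eventually_elim (auto simp: symS_iff)
  then have "(LINT r|N. u r * h r $ i $ j) = (LINT r|N. u r * h r $ j $ i)"
    by (intro Bochner_Integration.integral_cong_AE borel_measurable_times u h_measurable)
  then show "(\<chi> i j. LINT r|N. u r * h r $ i $ j) $ i $ j = (\<chi> i j. LINT r|N. u r * h r $ i $ j) $ j $ i"
    by simp
qed

lemma zero_in_sets: "{0} \<in> sets N"
  using measurable_sets[OF id_measurable, of "{0}"] by (simp add: space_UNIV vimage_def)

lemma weighted_form:
  assumes u: "u \<in> borel_measurable N" and bdd: "AE r in N. \<bar>u r\<bar> \<le> B"
  shows "integrable N (\<lambda>r. u r * (v \<bullet> (h r *v v)))"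
    and "v \<bullet> (weighted u *v v) = (LINT r|N. u r * (v \<bullet> (h r *v v)))"
proof -
  have form: "u r * (v \<bullet> (h r *v v)) = (\<Sum>i\<in>UNIV. \<Sum>j\<in>UNIV. (u r * h r $ i $ j) * (v$i * v$j))" for r
    by (simp add: inner_vec_def matrix_vector_mult_def sum_distrib_left mult_ac)
  have int: "integrable N (\<lambda>r. (u r * h r $ i $ j) * c)" for i j c
    by (intro integrable_mult_left integrable_weighted[OF u bdd])
  show "integrable N (\<lambda>r. u r * (v \<bullet> (h r *v v)))"
    unfolding form by (intro Bochner_Integration.integrable_sum int)
  have "(LINT r|N. u r * (v \<bullet> (h r *v v)))
      = (\<Sum>i\<in>UNIV. \<Sum>j\<in>UNIV. LINT r|N. (u r * h r $ i $ j) * (v$i * v$j))"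
    unfolding form
    by (subst Bochner_Integration.integral_sum, intro Bochner_Integration.integrable_sum int)
       (intro sum.cong refl Bochner_Integration.integral_sum int)
  also have "\<dots> = (\<Sum>i\<in>UNIV. \<Sum>j\<in>UNIV. weighted u $ i $ j * (v$i * v$j))"
    by (simp only: integral_mult_left_zero weighted_def vec_lambda_beta)
  also have "\<dots> = v \<bullet> (weighted u *v v)"
    by (simp add: inner_vec_def matrix_vector_mult_def sum_distrib_left mult_ac)
  finally show "v \<bullet> (weighted u *v v) = (LINT r|N. u r * (v \<bullet> (h r *v v)))" ..
qed

text \<open>The integrand is nonnegative almost everywhere, so the integral is at least the
  contribution of the atom at 0.\<close>

lemma weighted_form_ge:
  assumes u: "u \<in> borel_measurable N" and bdd: "AE r in N. \<bar>u r\<bar> \<le> B" and u0: "AE r in N. 0 \<le> u r"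
  shows "u 0 * (v \<bullet> ((measure N {0} *\<^sub>R h 0) *v v)) \<le> v \<bullet> (weighted u *v v)"
proof -
  let ?c = "u 0 * (v \<bullet> (h 0 *v v))"
  have "u 0 * (v \<bullet> ((measure N {0} *\<^sub>R h 0) *v v)) = (LINT r|N. indicator {0} r * ?c)"
    using zero_in_sets by (simp add: scaleR_matrix_vector_assoc[symmetric] space_UNIV)
  also have "\<dots> \<le> (LINT r|N. u r * (v \<bullet> (h r *v v)))"
  proof (rule integral_mono_AE)
    show "integrable N (\<lambda>r. indicator {0} r * ?c)"
      using zero_in_sets by (intro integrable_mult_left integrable_real_indicator) (auto simp: emeasure_eq_measure)
    show "AE r in N. indicator {0} r * ?c \<le> u r * (v \<bullet> (h r *v v))"
      using u0 h_psd by eventually_elim (auto simp: real_psd_def indicator_def)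
  qed (rule weighted_form(1)[OF u bdd])
  finally show ?thesis
    by (simp only: weighted_form(2)[OF u bdd])
qed

lemma real_psd_weighted:
  assumes u: "u \<in> borel_measurable N" and bdd: "AE r in N. \<bar>u r\<bar> \<le> B" and u0: "AE r in N. 0 \<le> u r"
  shows "real_psd (weighted u)"
  unfolding real_psd_def
proof
  fix v
  have "AE r in N. 0 \<le> u r * (v \<bullet> (h r *v v))"
    using u0 h_psd by eventually_elim (auto simp: real_psd_def)
  then show "0 \<le> v \<bullet> (weighted u *v v)"
    unfolding weighted_form(2)[OF u bdd] by (rule integral_nonneg_AE)
qed

lemma real_posdef_weighted:
  assumes u: "u \<in> borel_measurable N" and bdd: "AE r in N. \<bar>u r\<bar> \<le> B"
    and u0: "AE r in N. 0 \<le> u r" "0 < u 0"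
  shows "real_posdef (weighted u)"
  unfolding real_posdef_def
proof (intro allI impI)
  fix v :: "real^'n" assume "v \<noteq> 0"
  then have "0 < v \<bullet> ((measure N {0} *\<^sub>R h 0) *v v)"
    using atom_posdef unfolding real_posdef_def by blast
  from mult_pos_pos[OF u0(2) this] weighted_form_ge[OF u bdd u0(1), of v]
  show "0 < v \<bullet> (weighted u *v v)" by linarith
qed

lemma stieltjes_sectorial:
  assumes p: "p \<in> slit_plane"
  shows "sectorial p (stieltjes p)"
proof -
  obtain \<delta> where \<delta>: "0 < \<delta>" "\<And>r. 0 \<le> r \<Longrightarrow> \<delta> \<le> cmod (p + complex_of_real r)"
    using slit_plane_dist[OF p] by blast
  define a where "a r = (cmod p)\<^sup>2 / (cmod (p + complex_of_real r))\<^sup>2" for r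
  define b where "b r = r / (cmod (p + complex_of_real r))\<^sup>2" for r
  note [measurable] = id_measurable
  have meas: "a \<in> borel_measurable N" "b \<in> borel_measurable N"
    unfolding a_def[abs_def] b_def[abs_def] by measurable
  have a_bdd: "AE r in N. \<bar>a r\<bar> \<le> (cmod p)\<^sup>2 / \<delta>\<^sup>2"
    using nonneg_support
  proof eventually_elim
    case (elim r)
    then show ?case
      using \<delta>(1) \<delta>(2)[OF elim] by (auto simp: a_def intro!: frac_le power_mono)
  qed
  \<comment> \<open>The numerator r is unbounded, but r \<le> |p + r| + |p|; one power of the
    denominator absorbs the first summand.\<close>
  have b_bdd: "AE r in N. \<bar>b r\<bar> \<le> 1 / \<delta> + cmod p / \<delta>\<^sup>2"
    using nonneg_support
  proof eventually_elim
    case (elim r)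
    let ?m = "cmod (p + complex_of_real r)"
    have m: "\<delta> \<le> ?m" "0 < ?m" using \<delta>(1) \<delta>(2)[OF elim] by linarith+
    have "r \<le> ?m + cmod p"
      using norm_triangle_ineq4[of "p + complex_of_real r" p] elim by simp
    then have "r / ?m\<^sup>2 \<le> (?m + cmod p) / ?m\<^sup>2"
      by (intro divide_right_mono) auto
    also have "\<dots> = 1 / ?m + cmod p / ?m\<^sup>2"
      using m(2) by (simp add: add_divide_distrib power2_eq_square)
    also have "\<dots> \<le> 1 / \<delta> + cmod p / \<delta>\<^sup>2"
      using m \<delta>(1) by (intro add_mono frac_le power_mono) auto
    finally show ?case using elim by (simp add: b_def)
  qed
  have pos: "AE r in N. 0 \<le> a r" "AE r in N. 0 \<le> b r"
    using nonneg_support by (auto simp: a_def b_def)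
  \<comment> \<open>The weight at the atom is 1, as p is nonzero; the atom therefore makes the first
    coefficient definite.\<close>
  have "0 < a 0"
    using p by (auto simp: a_def slit_plane_iff)
  then have posdef: "real_posdef (weighted a)"
    by (intro real_posdef_weighted[OF meas(1) a_bdd pos(1)])
  have "stieltjes p $ i $ j = (cmat_of (weighted a) + cmat_scale p (cmat_of (weighted b))) $ i $ j" for i j
  proof -
    let ?A = "\<lambda>r. complex_of_real (a r * h r $ i $ j)" and ?B = "\<lambda>r. complex_of_real (b r * h r $ i $ j)"
    have "AE r in N. p * (complex_of_real (h r $ i $ j) / (p + complex_of_real r)) = ?A r + p * ?B r"
      using nonneg_support
    proof eventually_elim
      case (elim r)
      let ?z = "p + complex_of_real r"
      have z0: "?z \<noteq> 0" using \<delta>(1) \<delta>(2)[OF elim] by auto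
      have z: "?z * cnj ?z = complex_of_real ((cmod ?z)\<^sup>2)"
        by (simp only: complex_norm_square)
      have "complex_of_real (a r) + p * complex_of_real (b r) = p * cnj ?z / complex_of_real ((cmod ?z)\<^sup>2)"
      proof -
        have "p * cnj ?z = complex_of_real ((cmod p)\<^sup>2) + p * complex_of_real r"
          unfolding complex_norm_square by (simp add: algebra_simps)
        then show ?thesis
          unfolding a_def b_def of_real_divide by (simp only: add_divide_distrib times_divide_eq_right)
      qed
      also have "\<dots> = p / ?z"
        unfolding z[symmetric] using z0
        by (intro nonzero_mult_divide_mult_cancel_right) (simp only: complex_cnj_zero_iff not_False_eq_True)
      finally have "p * (complex_of_real (h r $ i $ j) / ?z)
          = (complex_of_real (a r) + p * complex_of_real (b r)) * complex_of_real (h r $ i $ j)"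
        by simp
      then show ?case
        by (simp add: algebra_simps)
    qed
    then have "(LINT r|N. p * (complex_of_real (h r $ i $ j) / (p + complex_of_real r))) = (LINT r|N. ?A r + p * ?B r)"
    proof (rule Bochner_Integration.integral_cong_AE[rotated 2])
      note [measurable] = meas
      show "(\<lambda>r. p * (complex_of_real (h r $ i $ j) / (p + complex_of_real r))) \<in> borel_measurable N"
        by measurable
      show "(\<lambda>r. ?A r + p * ?B r) \<in> borel_measurable N"
        by measurable
    qed
    also have "\<dots> = (LINT r|N. ?A r) + p * (LINT r|N. ?B r)"
      using integrable_weighted[OF meas(1) a_bdd, of i j] integrable_weighted[OF meas(2) b_bdd, of i j]
      by (subst Bochner_Integration.integral_add)
         (auto simp only: integral_mult_right_zero complex_of_real_integrable_eq intro!: integrable_mult_right)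
    finally show ?thesis
      by (simp only: stieltjes_def cmat_of_def cmat_scale_def weighted_def vec_lambda_beta
          vector_add_component integral_mult_right_zero integral_complex_of_real)
  qed
  then have "stieltjes p = cmat_of (weighted a) + cmat_scale p (cmat_of (weighted b))"
    by (simp add: vec_eq_iff)
  then show ?thesis
    unfolding sectorial_def
    using posdef symS_weighted[OF meas(1)] symS_weighted[OF meas(2)] real_psd_weighted[OF meas(2) b_bdd pos(2)]
    by blast
qed

text \<open>On the positive half-axis the weight x / (x + r) equals 1 at r = 0 for every x. The atom
  thus contributes the same amount for all x > 0, which gives a constant that does not degenerate as
  x tends to 0.\<close>

lemma stieltjes_coercive:
  "\<exists>\<gamma>>0. \<gamma> \<le> 1 \<and> (\<forall>x>0. \<forall>w. \<gamma> * (w \<bullet> w) \<le> Re (cform (stieltjes (complex_of_real x)) w))"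
proof -
  obtain \<gamma> where \<gamma>: "0 < \<gamma>" "\<gamma> \<le> 1" "\<And>v. \<gamma> * (v \<bullet> v) \<le> v \<bullet> ((measure N {0} *\<^sub>R h 0) *v v)"
    using real_posdef_coercive[OF atom_posdef] by blast
  have "\<gamma> * (w \<bullet> w) \<le> Re (cform (stieltjes (complex_of_real x)) w)" if x: "0 < x" for x and w :: "complex^'n"
  proof -
    define u where "u r = x / (x + r)" for r
    note [measurable] = id_measurable
    have meas: "u \<in> borel_measurable N" unfolding u_def[abs_def] by measurable
    have u0: "u 0 = 1" using x by (simp add: u_def)
    have bdd: "AE r in N. \<bar>u r\<bar> \<le> 1" and pos: "AE r in N. 0 \<le> u r"
      using nonneg_support x by (auto simp: u_def)
    have "complex_of_real x * (LINT r|N. complex_of_real (h r $ i $ j) / (complex_of_real x + complex_of_real r))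
        = complex_of_real (LINT r|N. u r * h r $ i $ j)" for i j
    proof -
      have "complex_of_real (u r * h r $ i $ j) = complex_of_real x *
          (complex_of_real (h r $ i $ j) / (complex_of_real x + complex_of_real r))" for r
        by (simp add: u_def)
      then show ?thesis
        by (simp only: integral_complex_of_real[symmetric] integral_mult_right_zero)
    qed
    then have eq: "stieltjes (complex_of_real x) = cmat_of (weighted u)"
      by (simp add: stieltjes_def weighted_def cmat_of_def)
    have form: "\<gamma> * (v \<bullet> v) \<le> v \<bullet> (weighted u *v v)" for v
      using \<gamma>(3)[of v] weighted_form_ge[OF meas bdd pos, of v] u0 by simp
    have "w \<bullet> w = (\<chi> i. Re (w$i)) \<bullet> (\<chi> i. Re (w$i)) + (\<chi> i. Im (w$i)) \<bullet> (\<chi> i. Im (w$i))"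
      by (simp add: inner_vec_def inner_complex_def sum.distrib)
    then show ?thesis
      unfolding eq cform_cmat_of[OF symS_weighted[OF meas]]
      using form[of "\<chi> i. Re (w$i)"] form[of "\<chi> i. Im (w$i)"] by (simp add: distrib_left)
  qed
  with \<gamma> show ?thesis by blast
qed

lemma stieltjes_holomorphic: "(\<lambda>p. stieltjes p $ i $ j) holomorphic_on slit_plane"
proof -
  have "AE r in N. \<bar>h r $ i $ j\<bar> \<le> C"
    using h_bounded by eventually_elim simp
  from holomorphic_stieltjes[OF h_measurable id_measurable this nonneg_support]
  show ?thesis
    unfolding stieltjes_def by (simp add: holomorphic_on_mult[OF holomorphic_on_ident])
qed

end

section \<open>The viscoelastic symbol\<close>

lemma (in finite_measure) integrable_stieltjes:
  fixes g \<xi> :: "'a \<Rightarrow> real"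
  assumes [measurable]: "g \<in> borel_measurable M" "\<xi> \<in> borel_measurable M"
    and gC: "AE r in M. \<bar>g r\<bar> \<le> C" and \<xi>0: "AE r in M. 0 \<le> \<xi> r" and p: "p \<in> slit_plane"
  shows "integrable M (\<lambda>r. complex_of_real (g r) / (p + complex_of_real (\<xi> r)))"
proof -
  obtain \<delta> where \<delta>: "0 < \<delta>" "\<And>r. 0 \<le> r \<Longrightarrow> \<delta> \<le> cmod (p + complex_of_real r)"
    using slit_plane_dist[OF p] by blast
  show ?thesis
  proof (rule integrable_const_bound)
    show "AE r in M. cmod (complex_of_real (g r) / (p + complex_of_real (\<xi> r))) \<le> C / \<delta>"
      using gC \<xi>0
    proof eventually_elim
      case (elim r)
      then show ?case
        unfolding norm_divide norm_of_real using \<delta> by (intro frac_le) auto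
    qed
  qed measurable
qed

text \<open>The norm bound is tested on E = e_kl + e_lk, a symmetric matrix. The minor symmetry
  gives 2 X_ijkl as the (i, j) entry of X E, while the squared norm of E is at most 4, with equality
  when k = l.\<close>

lemma tensor_entry_le:
  assumes X: "inW X" and norm: "tensor_norm_le1 X"
  shows "\<bar>X i j k l\<bar> \<le> 1"
proof -
  define E :: "real^'a^'a" where
    "E = (\<chi> a b. (if a = k \<and> b = l then 1 else 0) + (if a = l \<and> b = k then 1 else 0))"
  have minor: "X a b l k = X a b k l" for a b
    using X[unfolded inW_def, rule_format, of a b l k] by (elim conjE) simp
  have E_entry: "E $ a $ b = (if a = k \<and> b = l then 1 else 0) + (if a = l \<and> b = k then 1 else 0)" for a b
    by (simp only: E_def vec_lambda_beta)
  have E: "symS E"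
    unfolding symS_iff E_entry by (simp only: conj_commute add.commute simp_thms)
  have delta: "(\<Sum>a\<in>UNIV. \<Sum>b\<in>UNIV. f a b * (if a = c \<and> b = d then 1 else 0)) = f c d"
    for f :: "'a \<Rightarrow> 'a \<Rightarrow> real" and c d
  proof -
    have "(\<Sum>b\<in>UNIV. f a b * (if a = c \<and> b = d then 1 else 0)) = (if a = c then f a d else 0)" for a
      by (cases "a = c") (simp_all add: if_distrib cong: if_cong)
    then show ?thesis by simp
  qed
  have apply_E: "tapply X E $ a $ b = 2 * X a b k l" for a b
    by (simp add: tapply_def E_def distrib_left sum.distrib delta minor)
  have "E $ a $ b * E $ a $ b = E $ a $ b * (if a = k \<and> b = l then 1 else 0)
      + E $ a $ b * (if a = l \<and> b = k then 1 else 0)" for a b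
    by (metis E_entry distrib_left)
  then have "frob E E = E $ k $ l + E $ l $ k"
    by (simp only: frob_def sum.distrib delta)
  moreover have "E $ a $ b \<le> 1 + 1" for a b
    unfolding E_entry by (intro add_mono) simp_all
  note this[of k l] this[of l k]
  ultimately have frobE: "frob E E \<le> 4"
    by linarith
  have "(tapply X E $ i $ j)\<^sup>2 \<le> (\<Sum>b\<in>UNIV. (tapply X E $ i $ b)\<^sup>2)"
    by (intro member_le_sum) auto
  also have "\<dots> \<le> (\<Sum>a\<in>UNIV. \<Sum>b\<in>UNIV. (tapply X E $ a $ b)\<^sup>2)"
    by (intro member_le_sum[of _ _ "\<lambda>a. \<Sum>b\<in>UNIV. (tapply X E $ a $ b)\<^sup>2"]) (auto intro: sum_nonneg)
  also have "\<dots> = frob (tapply X E) (tapply X E)"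
    by (simp add: frob_def power2_eq_square)
  also have "\<dots> \<le> frob E E"
    using norm E by (simp add: tensor_norm_le1_def)
  finally have "(2 * X i j k l)\<^sup>2 \<le> 4"
    unfolding apply_E using frobE by linarith
  then have "(X i j k l)\<^sup>2 \<le> 1"
    by (simp add: power_mult_distrib)
  then show ?thesis
    by (simp add: abs_square_le_1)
qed

lemma symS_contr:
  assumes "inW X"
  shows "symS (contr X m)"
proof -
  have major: "X i j k l * m$j * m$l = X k l i j * m$l * m$j" for i j k l
  proof -
    have "X i j k l = X k l i j" using assms unfolding inW_def by blast
    then show ?thesis by simp
  qed
  have "contr X m $ i $ k = contr X m $ k $ i" for i k
  proof -
    have "contr X m $ i $ k = (\<Sum>j\<in>UNIV. \<Sum>l\<in>UNIV. X k l i j * m$l * m$j)"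
      unfolding contr_def vec_lambda_beta by (intro sum.cong refl major)
    also have "\<dots> = contr X m $ k $ i"
      by (subst sum.swap) (simp add: contr_def)
    finally show ?thesis .
  qed
  then show ?thesis
    by (simp add: symS_iff)
qed

text \<open>Positivity is tested on the symmetrised product E = v m^T + m v^T. By the minor
  symmetries the four resulting terms coincide, so the form of X at E is 4 times that of the
  contracted matrix at v.\<close>

lemma real_psd_contr:
  assumes X: "inW X" and psd: "tensor_psd X"
  shows "real_psd (contr X m)"
  unfolding real_psd_def
proof
  fix v
  define E where "E = (\<chi> i j. v$i * m$j + v$j * m$i)"
  have minor: "X i j l k = X i j k l" "X j i k l = X i j k l" for i j k l
    using X unfolding inW_def by metis+
  have swap: "(\<Sum>k\<in>UNIV. \<Sum>l\<in>UNIV. X i j k l * (v$l * m$k)) = (\<Sum>k\<in>UNIV. \<Sum>l\<in>UNIV. X i j k l * (v$k * m$l))" for i j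
    by (subst sum.swap) (simp add: minor(1))
  have apply_E: "tapply X E $ i $ j = 2 * (\<Sum>k\<in>UNIV. \<Sum>l\<in>UNIV. X i j k l * (v$k * m$l))" for i j
    by (simp add: tapply_def E_def distrib_left sum.distrib swap)
  have sym: "tapply X E $ j $ i = tapply X E $ i $ j" for i j
    unfolding apply_E by (simp add: minor(2))
  have "frob (tapply X E) E = (\<Sum>i\<in>UNIV. \<Sum>j\<in>UNIV. tapply X E $ i $ j * (v$i * m$j))
      + (\<Sum>i\<in>UNIV. \<Sum>j\<in>UNIV. tapply X E $ i $ j * (v$j * m$i))"
    unfolding frob_def by (subst (2) E_def) (simp add: distrib_left sum.distrib)
  also have "(\<Sum>i\<in>UNIV. \<Sum>j\<in>UNIV. tapply X E $ i $ j * (v$j * m$i)) = (\<Sum>i\<in>UNIV. \<Sum>j\<in>UNIV. tapply X E $ i $ j * (v$i * m$j))"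
    by (subst sum.swap) (simp add: sym)
  also have "(\<Sum>i\<in>UNIV. \<Sum>j\<in>UNIV. tapply X E $ i $ j * (v$i * m$j)) = 2 * (v \<bullet> (contr X m *v v))"
  proof -
    have "(\<Sum>j\<in>UNIV. tapply X E $ i $ j * (v$i * m$j)) = 2 * (v$i * (contr X m *v v) $ i)" for i
    proof -
      have "(\<Sum>j\<in>UNIV. tapply X E $ i $ j * (v$i * m$j))
          = 2 * v$i * (\<Sum>j\<in>UNIV. \<Sum>k\<in>UNIV. \<Sum>l\<in>UNIV. X i j k l * m$j * m$l * v$k)"
        unfolding apply_E by (simp add: sum_distrib_left sum_distrib_right mult_ac)
      also have "(\<Sum>j\<in>UNIV. \<Sum>k\<in>UNIV. \<Sum>l\<in>UNIV. X i j k l * m$j * m$l * v$k) = (contr X m *v v) $ i"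
        by (subst sum.swap) (simp add: contr_def matrix_vector_mult_def sum_distrib_right)
      finally show ?thesis by simp
    qed
    then show ?thesis
      by (simp add: inner_vec_def sum_distrib_left)
  qed
  finally have "frob (tapply X E) E = 4 * (v \<bullet> (contr X m *v v))"
    by simp
  moreover have "symS E"
    by (simp add: symS_iff E_def)
  ultimately have "0 \<le> 4 * (v \<bullet> (contr X m *v v))"
    using psd unfolding tensor_psd_def by metis
  then show "0 \<le> v \<bullet> (contr X m *v v)"
    by linarith
qed

section \<open>From sectorial matrices to the complete Bernstein property\<close>

lemma sectorial_transpose:
  assumes "sectorial p A"
  shows "transpose A = A"
  using assms by (auto simp: sectorial_def symS_iff transpose_def vec_eq_iff cmat_of_def cmat_scale_def)

lemma sectorial_real:
  fixes A :: "complex^'n^'n"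
  assumes "sectorial (complex_of_real x) A"
  shows "A $ i $ j \<in> \<real>"
  using assms by (auto simp: sectorial_def cmat_of_def cmat_scale_def)

lemma cform_cmat_Im: "cform (cmat_Im X) v = complex_of_real (Im (cform X v))"
proof -
  have "(\<Sum>i\<in>UNIV. \<Sum>j\<in>UNIV. cnj (v$i) * cnj (X$j$i) * v$j) = cnj (cform X v)"
    unfolding cform_def by (subst sum.swap) (simp add: mult_ac)
  moreover have "cform (cmat_Im X) v = (cform X v - (\<Sum>i\<in>UNIV. \<Sum>j\<in>UNIV. cnj (v$i) * cnj (X$j$i) * v$j)) / (2 * \<i>)"
    by (simp add: cform_def cmat_Im_def sum_subtractf[symmetric] sum_divide_distrib algebra_simps diff_divide_distrib)
  ultimately show ?thesis
    by (simp add: complex_eq_iff Re_divide Im_divide)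
qed

lemma Re_cform_of_real:
  fixes X :: "complex^'n^'n" and v :: "real^'n"
  shows "Re (cform X (\<chi> i. complex_of_real (v$i))) = v \<bullet> ((\<chi> i j. Re (X$i$j)) *v v)"
  by (simp add: cform_def inner_vec_def matrix_vector_mult_def sum_distrib_left mult_ac)

text \<open>All of the complete Bernstein property, for any holomorphic family of sectorial matrices
  that is uniformly coercive on the positive half-axis. The scalar \<rho> of this statement is
  instantiated later by the square root of the density.\<close>

lemma mCBF_scaled_isqrt:
  fixes Q F :: "complex \<Rightarrow> complex^'n^'n"
  assumes \<rho>: "0 < \<rho>"
    and F0: "F 0 = 0"
    and F: "\<And>p. p \<in> slit_plane \<Longrightarrow> F p = cmat_scale (complex_of_real \<rho> * p) (isqrt (Q p))"
    and sect: "\<And>p. p \<in> slit_plane \<Longrightarrow> sectorial p (Q p)"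
    and hol: "\<And>i j. (\<lambda>p. Q p $ i $ j) holomorphic_on slit_plane"
    and g: "0 < \<gamma>" "\<gamma> \<le> 1"
    and coercive: "\<And>x w. 0 < x \<Longrightarrow> \<gamma> * (w \<bullet> w) \<le> Re (cform (Q (complex_of_real x)) w)"
  shows "mCBF_with_ext (\<lambda>x. \<chi> i j. Re (F (complex_of_real x) $ i $ j)) F"
proof -
  let ?A = "\<lambda>x. \<chi> i j. Re (F (complex_of_real x) $ i $ j)"
  have slit: "complex_of_real x \<in> slit_plane" if "0 < x" for x
    using that by (simp add: slit_plane_iff)
  have pencil: "regular_pencil (Q p)" if "p \<in> slit_plane" for p
    using sect[OF that] that by (rule sectorial_regular_pencil)
  have Fx: "F (complex_of_real x) $ i $ j = complex_of_real (\<rho> * x * Re (isqrt (Q (complex_of_real x)) $ i $ j))"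
    if "0 < x" for x i j
  proof -
    have "isqrt (Q (complex_of_real x)) $ i $ j \<in> \<real>"
      by (intro isqrt_real pencil slit that sectorial_real[of x] sect)
    then have "isqrt (Q (complex_of_real x)) $ i $ j = complex_of_real (Re (isqrt (Q (complex_of_real x)) $ i $ j))"
      by simp
    then show ?thesis
      unfolding F[OF slit[OF that]] cmat_scale_def by (simp add: mult.assoc)
  qed
  have "symS (?A x) \<and> real_psd (?A x)" if "0 \<le> x" for x
  proof (cases "x = 0")
    case True
    then show ?thesis by (simp add: F0 symS_iff real_psd_def inner_vec_def matrix_vector_mult_def)
  next
    case False
    then have x: "0 < x" using that by simp
    have "symS (?A x)"
      using isqrt_symmetric[OF pencil[OF slit[OF x]] sectorial_transpose[OF sect[OF slit[OF x]]]]
      by (simp add: symS_iff Fx[OF x])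
    moreover have "0 \<le> v \<bullet> (?A x *v v)" for v
    proof (cases "v = 0")
      case False
      let ?v = "\<chi> i. complex_of_real (v$i)"
      have "?v \<noteq> 0" using False by (simp add: vec_eq_iff)
      from isqrt_form[OF sect[OF slit[OF x]] slit[OF x] this]
      obtain s t where st: "0 < s" "0 \<le> t"
          "cform (isqrt (Q (complex_of_real x))) ?v = complex_of_real s + cnj (complex_of_real x) * complex_of_real t"
        by blast
      have "v \<bullet> (?A x *v v) = \<rho> * x * (s + x * t)"
        unfolding Re_cform_of_real[symmetric] F[OF slit[OF x]] cform_cmat_scale st(3) by simp
      then show ?thesis using st \<rho> x by simp
    qed simp
    ultimately show ?thesis by (simp add: real_psd_def)
  qed
  moreover have "(?A \<longlongrightarrow> ?A 0) (at_right 0)"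
  proof (intro vec_tendstoI)
    fix i j
    have "((\<lambda>x. ?A x $ i $ j) \<longlongrightarrow> 0) (at_right 0)"
    proof (rule Lim_null_comparison)
      have "((\<lambda>x. \<rho> * x * (1 / \<gamma>)) \<longlongrightarrow> \<rho> * 0 * (1 / \<gamma>)) (at_right 0)"
        by (intro tendsto_intros)
      then show "((\<lambda>x. \<rho> * x * (1 / \<gamma>)) \<longlongrightarrow> 0) (at_right 0)" by simp
      have "norm (?A x $ i $ j) \<le> \<rho> * x * (1 / \<gamma>)" if x: "0 < x" for x
      proof -
        have "\<bar>Re (isqrt (Q (complex_of_real x)) $ i $ j)\<bar> \<le> 1 / \<gamma>"
          using norm_isqrt_entry_le[OF pencil[OF slit[OF x]] g coercive[OF x], of i j]
            abs_Re_le_cmod order_trans by blast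
        then have "\<rho> * x * \<bar>Re (isqrt (Q (complex_of_real x)) $ i $ j)\<bar> \<le> \<rho> * x * (1 / \<gamma>)"
          using \<rho> x by (intro mult_left_mono) auto
        then show ?thesis
          using \<rho> x by (simp add: Fx[OF x] abs_mult)
      qed
      then show "\<forall>\<^sub>F x in at_right 0. norm (?A x $ i $ j) \<le> \<rho> * x * (1 / \<gamma>)"
        by (auto simp: eventually_at_right_less intro: eventually_mono[OF eventually_at_right_less])
    qed
    then show "((\<lambda>x. ?A x $ i $ j) \<longlongrightarrow> ?A 0 $ i $ j) (at_right 0)"
      by (simp add: F0)
  qed
  moreover have "(\<lambda>z. F z $ i $ j) holomorphic_on slit_plane" for i j
  proof -
    have "(\<lambda>z. complex_of_real \<rho> * z * isqrt (Q z) $ i $ j) holomorphic_on slit_plane"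
      by (intro holomorphic_intros holomorphic_isqrt open_slit_plane hol pencil)
    then show ?thesis
      by (rule holomorphic_transform) (simp add: F cmat_scale_def)
  qed
  moreover have "F (complex_of_real x) = cmat_of (?A x)" if "0 < x" for x
    by (simp add: vec_eq_iff cmat_of_def Fx[OF that])
  moreover have "cmat_nonneg (cmat_scale (complex_of_real (Im z)) (cmat_Im (F z)))" if z: "z \<in> slit_plane" for z
  proof -
    have "0 \<le> Im z * Im (cform (F z) v)" for v
    proof (cases "v = 0")
      case False
      from isqrt_form[OF sect[OF z] z this]
      obtain s t where st: "0 < s" "0 \<le> t" "cform (isqrt (Q z)) v = complex_of_real s + cnj z * complex_of_real t"
        by blast
      have "Im z * Im (cform (F z) v) = \<rho> * s * (Im z)\<^sup>2"
        unfolding F[OF z] cform_cmat_scale st(3) by (simp add: algebra_simps power2_eq_square)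
      then show ?thesis using st \<rho> by simp
    qed (simp add: cform_def)
    then have "0 \<le> Re (cform (cmat_scale (complex_of_real (Im z)) (cmat_Im (F z))) v)" for v
      by (simp add: cform_cmat_scale cform_cmat_Im)
    then show ?thesis
      by (simp add: cmat_nonneg_def cform_def)
  qed
  ultimately show ?thesis
    unfolding mCBF_with_ext_def by blast
qed

theorem mainTheorem2:
  fixes \<rho> :: real and M :: "real measure" and H :: "real \<Rightarrow> 'n::finite tensor4"
    and nv :: "real^'n"
  assumes rho_pos: "\<rho> > 0"
    and M_borel: "sets M = sets borel"
    and M_finite: "finite_measure M"
    and M_support: "emeasure M (- {0..}) = 0"
    and M_nonzero: "emeasure M UNIV \<noteq> 0"
    and H_meas: "\<And>i j k l. (\<lambda>r. H r i j k l) \<in> borel_measurable (completion M)"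
    and H_W: "\<And>r. r \<ge> 0 \<Longrightarrow> inW (H r)"
    and H_psd: "AE r in M. tensor_psd (H r)"
    and H_norm: "AE r in M. tensor_norm_le1 (H r)"
    and G_inf_posdef: "\<And>m::real^'n. norm m = 1 \<Longrightarrow>
                          real_posdef (contr (\<lambda>i j k l. measure M {0} * H 0 i j k l) m)"
    and unit: "norm nv = 1"
  shows "is_mCBF (\<lambda>x. \<chi> i j. Re (Kn \<rho> M H nv (complex_of_real x) $ i $ j))
       \<and> mCBF_with_ext (\<lambda>x. \<chi> i j. Re (Kn \<rho> M H nv (complex_of_real x) $ i $ j)) (Kn \<rho> M H nv)"
proof -
  let ?N = "completion M" and ?h = "\<lambda>r. contr (H r) nv"
  have sp: "space M = UNIV"
    using sets_eq_imp_space_eq[OF M_borel] by simp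
  interpret N: finite_measure ?N
    using finite_measure.emeasure_finite[OF M_finite] by (intro finite_measureI) simp
  have id_meas: "(\<lambda>r. r) \<in> borel_measurable ?N"
    by (rule measurable_completion) (simp add: measurable_ident_sets[OF M_borel])
  have nonneg_M: "AE r in M. 0 \<le> r"
    using M_support by (intro AE_I[of _ _ "- {0..}"]) (auto simp: M_borel)
  have nonneg: "AE r in ?N. 0 \<le> r"
    using nonneg_M by (rule AE_completion)
  \<comment> \<open>The symmetries of \<open>H r\<close> are known only for r \<ge> 0, so the
    support condition enters together with the norm bound.\<close>
  have entry_le: "AE r in ?N. \<forall>i j k l. \<bar>H r i j k l\<bar> \<le> 1"
    using nonneg AE_completion[OF H_norm] by eventually_elim (blast intro: tensor_entry_le H_W)
  have zero_M: "{0} \<in> sets M" by (simp add: M_borel)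
  interpret psd_matrix_measure ?N ?h "real (CARD('n) * CARD('n))"
  proof
    show "(\<lambda>r. contr (H r) nv $ i $ j) \<in> borel_measurable ?N" for i j
      unfolding contr_def using H_meas by simp
    show "AE r in ?N. symS (contr (H r) nv)"
      using nonneg by eventually_elim (intro symS_contr H_W)
    show "AE r in ?N. real_psd (contr (H r) nv)"
      using nonneg AE_completion[OF H_psd] by eventually_elim (intro real_psd_contr H_W)
    show "AE r in ?N. \<forall>i j. \<bar>contr (H r) nv $ i $ j\<bar> \<le> real (CARD('n) * CARD('n))"
      using entry_le
    proof eventually_elim
      case (elim r)
      have nv1: "\<bar>nv $ j\<bar> \<le> 1" for j
        using component_le_norm_cart[of nv j] unit by simp
      have "\<bar>H r i j k l * nv$j * nv$l\<bar> \<le> 1" for i j k l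
        unfolding abs_mult using elim nv1 by (intro mult_le_one) auto
      then have "\<bar>contr (H r) nv $ i $ k\<bar> \<le> (\<Sum>j\<in>(UNIV::'n set). \<Sum>l\<in>(UNIV::'n set). 1)" for i k
        unfolding contr_def vec_lambda_beta
        by (intro order_trans[OF sum_abs] sum_mono order_trans[OF sum_abs])
      then show ?case by simp
    qed
    \<comment> \<open>The singleton {0} is a Borel set, so the completion gives it the same mass as
      \<open>M\<close>, and the standing assumption on the atom carries over.\<close>
    have "contr (\<lambda>i j k l. measure M {0} * H 0 i j k l) nv = measure ?N {0} *\<^sub>R contr (H 0) nv"
      using zero_M by (simp add: contr_def vec_eq_iff sum_distrib_left mult_ac measure_completion)
    then show "real_posdef (measure ?N {0} *\<^sub>R contr (H 0) nv)"
      using G_inf_posdef[OF unit] by simp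
  qed (simp_all add: sp id_meas nonneg)
  \<comment> \<open>Contraction and integration are exchanged. This uses integrability of every
    tensor entry against the kernel, hence the entrywise bound obtained above.\<close>
  have Q: "Qn M H nv p = stieltjes p" if p: "p \<in> slit_plane" for p
  proof -
    have int: "integrable ?N (\<lambda>r. complex_of_real (H r i j k l) / (p + complex_of_real r) * complex_of_real c)" for i j k l c
      using entry_le by (intro integrable_mult_left N.integrable_stieltjes[OF H_meas id_meas _ nonneg p, of _ _ _ _ 1]) auto
    have "Qn M H nv p $ i $ k = stieltjes p $ i $ k" for i k
    proof -
      have "(LINT r|?N. complex_of_real (contr (H r) nv $ i $ k) / (p + complex_of_real r))
          = (LINT r|?N. (\<Sum>j\<in>UNIV. \<Sum>l\<in>UNIV. complex_of_real (H r i j k l) / (p + complex_of_real r) * complex_of_real (nv$j * nv$l)))"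
        by (simp add: contr_def sum_divide_distrib mult.assoc)
      also have "\<dots> = (\<Sum>j\<in>UNIV. \<Sum>l\<in>UNIV. (LINT r|?N. complex_of_real (H r i j k l) / (p + complex_of_real r) * complex_of_real (nv$j * nv$l)))"
        by (subst Bochner_Integration.integral_sum, intro Bochner_Integration.integrable_sum int)
           (intro sum.cong refl Bochner_Integration.integral_sum int)
      finally show ?thesis
        by (simp only: Qn_def Qt_def stieltjes_def vec_lambda_beta integral_mult_left_zero sum_distrib_left mult.assoc)
    qed
    then show ?thesis by (simp add: vec_eq_iff)
  qed
  obtain \<gamma> where \<gamma>: "0 < \<gamma>" "\<gamma> \<le> 1"
      "\<And>x w. 0 < x \<Longrightarrow> \<gamma> * (w \<bullet> w) \<le> Re (cform (stieltjes (complex_of_real x)) w)"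
    using stieltjes_coercive by blast
  have "mCBF_with_ext (\<lambda>x. \<chi> i j. Re (Kn \<rho> M H nv (complex_of_real x) $ i $ j)) (Kn \<rho> M H nv)"
  proof (rule mCBF_scaled_isqrt)
    show "Kn \<rho> M H nv p = cmat_scale (complex_of_real (sqrt \<rho>) * p) (isqrt (stieltjes p))"
      if p: "p \<in> slit_plane" for p
    proof -
      have "p \<noteq> 0" using p by (auto simp: slit_plane_iff)
      then show ?thesis
        by (simp add: Kn_def Q[OF p] matrix_inv_psqrt[OF stieltjes_sectorial[OF p] p])
    qed
  qed (use rho_pos stieltjes_sectorial stieltjes_holomorphic \<gamma> in \<open>simp_all add: Kn_def\<close>)
  then show ?thesis
    unfolding is_mCBF_def by blast
qed

end
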